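(* Let $k,r\ge2$ be integers with $k\le r$, let $\Gamma$ be the symmetric graph of type $k$ and order $r$ with vertex set $\mathcal V$ and boundary $(\Omega,\nu)$, and put $Q=(r-1)(k-1)$, with $Q>1$, and $\tau=\frac{2\pi}{\ln Q}$. Then: (a) (Plancherel formula) For all $f\in\mathcal D(\mathcal V)$, $$\sum_{x\in\mathcal V}|f(x)|^2=\frac1{2\pi}\,\frac{Q\ln Q}{r(k-1)}\int_0^{\frac\tau2}\int_\Omega|\hat f(\lambda,\omega)|^2\,|c(\lambda)|^{-2}\,d\nu(\omega)\,d\lambda.$$ (b) (Inversion formula) For all $f\in\mathcal D(\mathcal V)$ and $x\in\mathcal V$, $$f(x)=\frac1{2\pi}\,\frac{Q\ln Q}{r(k-1)}\int_0^{\frac\tau2}\int_\Omega\hat f(\lambda,\omega)\,P(x,\omega)^{\frac12-i\lambda}\,|c(\lambda)|^{-2}\,d\nu(\omega)\,d\lambda.$$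
   Context: Symmetric graph: $\Gamma$ is a connected graph in which every vertex $v$ belongs to exactly $r$ polygons with $k$ sides each (for $k=2$ a polygon is a single edge), these polygons having no side and no vertex in common except $v$, and such that every nontrivial loop runs through all the edges of at least one polygon. $\mathcal V$ is its vertex set. The distance $d(x,y)$ is the minimal number of polygons crossed by a path connecting $x$ with $y$. Fix an origin $o\in\mathcal V$ and put $|x|=d(x,o)$. The sphere $\{x:|x|=n\}$ has cardinality $\delta(n)$, with $\delta(0)=1$ and $\delta(n)=r(k-1)Q^{n-1}$ for $n\ge1$. $\mathcal D(\mathcal V)$ is the space of finitely supported complex functions on $\mathcal V$. Boundary: $\Omega$ is the set of geodesic rays starting at $o$; a ray $\omega$ is identified with its sequence of nodes $\omega_0=o,\omega_1,\omega_2,\dots$ in $\mathcal V$, with $d(\omega_i,\omega_j)=|i-j|$. For $x\in\mathcal V$ with $|x|=n$, $E(x)=\{\omega\in\Omega:\omega_n=x\}$; these sets form a base of the topology of $\Omega$, and $\nu$ is the Borel probability measure on $\Omega$ with $\nu(E(x))=1/\delta(|x|)$. The Busemann function is $\zeta(x,\omega)=d(o,\omega_m)-d(x,\omega_m)$ for $m>|x|$ (independent of such $m$), and the Poisson kernel is $P(x,\omega)=Q^{\zeta(x,\omega)}$. Helgason–Fourier transform: $\hat f(\lambda,\omega)=\sum_{x\in\mathcal V}f(x)\,P(x,\omega)^{\frac12+i\lambda}$ for $f\in\mathcal D(\mathcal V)$, $\lambda\in\mathbb C$, $\omega\in\Omega$. The function $c$ is the meromorphic function, with $\sigma=k-2$,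 $$c(\lambda)=\frac{Q^{\frac12}}{r(k-1)}\,\frac{Q^{\frac12+i\lambda}-(k-1)Q^{-\frac12-i\lambda}+\sigma}{Q^{i\lambda}-Q^{-i\lambda}},\qquad\lambda\in\mathbb C\setminus\tfrac\tau2\mathbb Z.$$ *)

theory Defs
  imports "HOL-Probability.Probability"
begin

text \<open>
  A graph is given by its vertex set \<open>V\<close> and its set \<open>E\<close> of edges, each an unordered pair
  of distinct vertices. Closed walks are lists of vertices, read cyclically.
\<close>

definition is_walk :: "'v set \<Rightarrow> 'v set set \<Rightarrow> 'v list \<Rightarrow> bool" where
  "is_walk V E p \<longleftrightarrow> p \<noteq> [] \<and> set p \<subseteq> V \<and> (\<forall>i. Suc i < length p \<longrightarrow> {p ! i, p ! Suc i} \<in> E)"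

definition is_closed_walk :: "'v set \<Rightarrow> 'v set set \<Rightarrow> 'v list \<Rightarrow> bool" where
  "is_closed_walk V E c \<longleftrightarrow>
     c \<noteq> [] \<and> set c \<subseteq> V \<and> (\<forall>i<length c. {c ! i, c ! (Suc i mod length c)} \<in> E)"

definition closed_steps :: "'v list \<Rightarrow> ('v \<times> 'v) set" where
  "closed_steps c = {(c ! i, c ! (Suc i mod length c)) | i. i < length c}"

text \<open>
  A loop is nontrivial if it is not null-homotopic. Up to cancelling backtracking, such a loop is
  a closed walk that (cyclically) never turns back along the edge it has just used.
\<close>

definition nontrivial_loop :: "'v set \<Rightarrow> 'v set set \<Rightarrow> 'v list \<Rightarrow> bool" where
  "nontrivial_loop V E c \<longleftrightarrow> is_closed_walk V E c \<and>
     (\<forall>i<length c. c ! i \<noteq> c ! ((i + 2) mod length c))"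

text \<open>
  A \<open>k\<close>-gon as a list of its vertices in cyclic order. For \<open>k = 2\<close> this is \<open>[v, w]\<close> with
  \<open>{v, w}\<close> an edge. The same polygon is listed by several lists (rotations and reversals), so the
  polygons themselves are represented by their sets of edges.
\<close>

definition is_polygon :: "nat \<Rightarrow> 'v set \<Rightarrow> 'v set set \<Rightarrow> 'v list \<Rightarrow> bool" where
  "is_polygon k V E p \<longleftrightarrow> is_closed_walk V E p \<and> distinct p \<and> length p = k"

definition polygon_edges :: "'v list \<Rightarrow> 'v set set" where
  "polygon_edges p = (\<lambda>(x, y). {x, y}) ` closed_steps p"

definition polygons :: "nat \<Rightarrow> 'v set \<Rightarrow> 'v set set \<Rightarrow> 'v set set set" where
  "polygons k V E = polygon_edges ` {p. is_polygon k V E p}"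

text \<open>
  The symmetric graph of type \<open>k\<close> and order \<open>r\<close>. A loop runs through all the edges of a polygon if
  it makes all steps of the boundary circuit of the polygon, in one of its two orientations
  (both \<open>p\<close> and \<open>rev p\<close> are admissible in \<open>loops\<close>). For \<open>k \<ge> 3\<close> orienting the sides
  makes no difference. For \<open>k = 2\<close> it means that the polygon \<open>[v, w]\<close>, a single edge with the two
  sides \<open>(v, w)\<close> and \<open>(w, v)\<close>, must be traversed in both directions, so that \<open>loops\<close> excludes
  every simple cycle and the graph is the homogeneous tree of degree \<open>r\<close>; with unoriented edges
  \<open>loops\<close> would be void for \<open>k = 2\<close>.

  Assumption \<open>edge_in_polygon\<close> says that the graph is made of its polygons: there are no
  additional bridges.
\<close>

locale symmetric_graph =
  fixes k r :: nat and V :: "'v set" and E :: "'v set set"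
  assumes edges: "\<And>e. e \<in> E \<Longrightarrow> \<exists>x\<in>V. \<exists>y\<in>V. x \<noteq> y \<and> e = {x, y}"
    and connected: "\<And>x y. x \<in> V \<Longrightarrow> y \<in> V \<Longrightarrow> \<exists>p. is_walk V E p \<and> hd p = x \<and> last p = y"
    and edge_in_polygon: "\<And>e. e \<in> E \<Longrightarrow> \<exists>S\<in>polygons k V E. e \<in> S"
    and card_polygons: "\<And>v. v \<in> V \<Longrightarrow> card {S \<in> polygons k V E. v \<in> \<Union>S} = r"
    and polygons_meet: "\<And>v S T. v \<in> V \<Longrightarrow> S \<in> polygons k V E \<Longrightarrow> T \<in> polygons k V E \<Longrightarrow>
      v \<in> \<Union>S \<Longrightarrow> v \<in> \<Union>T \<Longrightarrow> S \<noteq> T \<Longrightarrow> S \<inter> T = {} \<and> \<Union>S \<inter> \<Union>T = {v}"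
    and loops: "\<And>c. nontrivial_loop V E c \<Longrightarrow>
      \<exists>p. is_polygon k V E p \<and> closed_steps p \<subseteq> closed_steps c"

definition crossed_polygons :: "nat \<Rightarrow> 'v set \<Rightarrow> 'v set set \<Rightarrow> 'v list \<Rightarrow> 'v set set set" where
  "crossed_polygons k V E p =
     {S \<in> polygons k V E. \<exists>i. Suc i < length p \<and> {p ! i, p ! Suc i} \<in> S}"

definition gdist :: "nat \<Rightarrow> 'v set \<Rightarrow> 'v set set \<Rightarrow> 'v \<Rightarrow> 'v \<Rightarrow> nat" where
  "gdist k V E x y = (LEAST n. \<exists>p. is_walk V E p \<and> hd p = x \<and> last p = y \<and>
     card (crossed_polygons k V E p) = n)"

text \<open>In the following, \<open>b\<close> is the origin of the graph.\<close>

definition sphere_card :: "nat \<Rightarrow> 'v set \<Rightarrow> 'v set set \<Rightarrow> 'v \<Rightarrow> nat \<Rightarrow> nat" where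
  "sphere_card k V E b n = card {x \<in> V. gdist k V E x b = n}"

definition boundary :: "nat \<Rightarrow> 'v set \<Rightarrow> 'v set set \<Rightarrow> 'v \<Rightarrow> (nat \<Rightarrow> 'v) set" where
  "boundary k V E b = {\<omega>. \<omega> 0 = b \<and> range \<omega> \<subseteq> V \<and>
     (\<forall>i j. int (gdist k V E (\<omega> i) (\<omega> j)) = \<bar>int i - int j\<bar>)}"

definition boundary_cyl :: "nat \<Rightarrow> 'v set \<Rightarrow> 'v set set \<Rightarrow> 'v \<Rightarrow> 'v \<Rightarrow> (nat \<Rightarrow> 'v) set" where
  "boundary_cyl k V E b x = {\<omega> \<in> boundary k V E b. \<omega> (gdist k V E x b) = x}"

definition boundary_topology :: "nat \<Rightarrow> 'v set \<Rightarrow> 'v set set \<Rightarrow> 'v \<Rightarrow> (nat \<Rightarrow> 'v) topology" where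
  "boundary_topology k V E b = topology_generated_by (boundary_cyl k V E b ` V)"

locale boundary_measure = prob_space \<nu>
  for k :: nat and V :: "'v set" and E :: "'v set set" and b :: 'v
    and \<nu> :: "(nat \<Rightarrow> 'v) measure" +
  assumes space_boundary: "space \<nu> = boundary k V E b"
    and sets_boundary:
      "sets \<nu> = sigma_sets (boundary k V E b) {U. openin (boundary_topology k V E b) U}"
    and measure_cyl: "\<And>x. x \<in> V \<Longrightarrow>
      measure \<nu> (boundary_cyl k V E b x) = 1 / real (sphere_card k V E b (gdist k V E x b))"

text \<open>The Busemann function, with the choice \<open>m = |x| + 1\<close>; any other \<open>m > |x|\<close> gives the same value.\<close>

definition busemann :: "nat \<Rightarrow> 'v set \<Rightarrow> 'v set set \<Rightarrow> 'v \<Rightarrow> 'v \<Rightarrow> (nat \<Rightarrow> 'v) \<Rightarrow> int" where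
  "busemann k V E b x \<omega> = (let m = gdist k V E x b + 1 in
     int (gdist k V E b (\<omega> m)) - int (gdist k V E x (\<omega> m)))"

definition poisson :: "nat \<Rightarrow> nat \<Rightarrow> 'v set \<Rightarrow> 'v set set \<Rightarrow> 'v \<Rightarrow> 'v \<Rightarrow> (nat \<Rightarrow> 'v) \<Rightarrow> real" where
  "poisson k r V E b x \<omega> = real ((r - 1) * (k - 1)) powi busemann k V E b x \<omega>"

text \<open>Only the values on \<open>V\<close> of a function on the type of vertices are relevant.\<close>

definition finsupp :: "'v set \<Rightarrow> ('v \<Rightarrow> complex) set" where
  "finsupp V = {f. finite {x \<in> V. f x \<noteq> 0}}"

definition hf_transform ::
  "nat \<Rightarrow> nat \<Rightarrow> 'v set \<Rightarrow> 'v set set \<Rightarrow> 'v \<Rightarrow> ('v \<Rightarrow> complex) \<Rightarrow> complex \<Rightarrow> (nat \<Rightarrow> 'v) \<Rightarrow> complex" where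
  "hf_transform k r V E b f l \<omega> =
     (\<Sum>\<^sub>\<infinity>x\<in>V. f x * complex_of_real (poisson k r V E b x \<omega>) powr (1/2 + \<i> * l))"

text \<open>At the poles in \<open>(\<tau>/2)\<int>\<close> the value is 0 by the convention for division by zero.\<close>

definition c_fun :: "nat \<Rightarrow> nat \<Rightarrow> complex \<Rightarrow> complex" where
  "c_fun k r l = (let Q = complex_of_real (real ((r - 1) * (k - 1))) in
     Q powr (1/2) / (of_nat r * (of_nat k - 1)) *
     ((Q powr (1/2 + \<i> * l) - (of_nat k - 1) * Q powr (- 1/2 - \<i> * l) + (of_nat k - 2)) /
      (Q powr (\<i> * l) - Q powr (- \<i> * l))))"

end

theory Submission
  imports Defs "HOL-Complex_Analysis.Complex_Analysis"
begin

text \<open>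
  The polygons form a tree-like structure: seen from any vertex \<open>z\<close>, each polygon has a unique
  nearest vertex, its gate, and all its other vertices are one step further away. Write
  \<open>u = Q\<^bsup>-1/2-i\<lambda>\<^esup>\<close> and \<open>v = Q\<^bsup>-1/2+i\<lambda>\<^esup>\<close>. Replacing the boundary by a large sphere, the integral
  \<open>\<integral> P(y,\<omega>)\<^bsup>1/2+i\<lambda>\<^esup> P(x,\<omega>)\<^bsup>1/2-i\<lambda>\<^esup> d\<nu>\<close> is, up to a constant, the sum of
  \<open>u\<^bsup>d(y,z)\<^esup> v\<^bsup>d(x,z)\<^esup>\<close> over the sphere. Moving \<open>y\<close> one step away from \<open>x\<close> changes it in a way that
  depends only on \<open>d(x,y)\<close>, since the mass of a branch, seen from a vertex outside, depends
  only on its distance. So it is a function \<open>\<phi>\<close> of \<open>n = d(x,y)\<close>, which solves a first-order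
  recursion with solution \<open>\<phi>(n) = c v\<^bsup>n\<^esup> + (1 - c) u\<^bsup>n\<^esup>\<close>, where \<open>1 - c\<close> is the conjugate of \<open>c\<close>.
  Hence \<open>\<phi>(n) |c|\<^bsup>-2\<^esup>\<close> is twice the real part of \<open>u\<^bsup>n\<^esup> / c\<close>. As a function of \<open>u\<close> the latter is
  holomorphic in the disc of radius \<open>Q\<^bsup>-1/2\<^esup>\<close>, because \<open>k \<le> r\<close> keeps the zero \<open>-1/(k-1)\<close> of \<open>c\<close> out
  of the disc (for \<open>k = r\<close> it is on the circle and cancels).
  By the mean value property its integral over the circle vanishes unless \<open>n = 0\<close>.
  This is the inversion formula, and the Plancherel formula follows by sesquilinearity.
\<close>

section \<open>Spherical functions and the density\<close>

text \<open>The spherical function at distance \<open>n\<close>, given by the recursion that the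
  sums over spheres satisfy in \<open>sum_sphere_kernel\<close>. There \<open>m\<close> is k - 1,
  \<open>\<kappa>\<close> is Q / (r (k - 1)), and u v = 1/Q.\<close>

fun spherical :: "complex \<Rightarrow> complex \<Rightarrow> complex \<Rightarrow> complex \<Rightarrow> nat \<Rightarrow> complex" where
  "spherical \<kappa> m u v 0 = 1"
| "spherical \<kappa> m u v (Suc n) = u * spherical \<kappa> m u v n + \<kappa> * (1 - u) * (1 + m * u) * v ^ Suc n"

text \<open>The homogeneous recursion has the solution \<open>u ^ n\<close>, and
  \<open>c * v ^ n\<close> is a particular solution because \<open>c * (v - u) * v ^ n\<close> is
  the inhomogeneous term. The value 1 at \<open>n = 0\<close> fixes the mixture.\<close>

lemma spherical_closed_form:
  assumes "u \<noteq> v" "c = \<kappa> * ((1 - u) * (1 + m * u)) * v / (v - u)"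
  shows "spherical \<kappa> m u v n = c * v ^ n + (1 - c) * u ^ n"
proof (induction n)
  case (Suc n)
  have c: "c * (v - u) = \<kappa> * ((1 - u) * (1 + m * u)) * v" using assms by simp
  have "spherical \<kappa> m u v (Suc n) =
      u * (c * v ^ n + (1 - c) * u ^ n) + \<kappa> * ((1 - u) * (1 + m * u)) * v * v ^ n"
    by (simp add: Suc.IH algebra_simps)
  also have "\<dots> = u * (c * v ^ n + (1 - c) * u ^ n) + c * (v - u) * v ^ n" by (simp add: c)
  also have "\<dots> = c * v ^ Suc n + (1 - c) * u ^ Suc n" by (simp add: algebra_simps)
  finally show ?case .
qed simp

section \<open>Mean values over circles\<close>

lemma has_integral_circle_mean:
  fixes g :: "complex \<Rightarrow> complex"
  assumes "R > 0" "continuous_on (cball 0 R) g" "g holomorphic_on ball 0 R"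
  shows "((\<lambda>t. g (of_real R * exp (2 * of_real pi * \<i> * of_real t))) has_integral g 0) {0..1}"
proof -
  have "((\<lambda>w. g w / (w - 0)) has_contour_integral 2 * of_real pi * \<i> * g 0) (circlepath 0 R)"
    using assms by (intro Cauchy_integral_circlepath) auto
  then have "((\<lambda>t. g (circlepath 0 R t) / circlepath 0 R t *
      vector_derivative (circlepath 0 R) (at t)) has_integral 2 * of_real pi * \<i> * g 0) {0..1}"
    unfolding has_contour_integral by simp
  then have "((\<lambda>t. 2 * of_real pi * \<i> * g (of_real R * exp (2 * of_real pi * \<i> * of_real t)))
      has_integral 2 * of_real pi * \<i> * g 0) {0..1}"
  \<comment> \<open>Along the circle the derivative of the path is 2 pi i times the point itself,
    which cancels the denominator of the Cauchy kernel.\<close>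
  proof (rule has_integral_eq[rotated])
    fix t :: real
    define w where "w = complex_of_real R * exp (2 * of_real pi * \<i> * of_real t)"
    have "circlepath 0 R t = w" by (simp add: circlepath w_def)
    moreover have "vector_derivative (circlepath 0 R) (at t) = 2 * of_real pi * \<i> * w"
      by (simp add: vector_derivative_circlepath w_def)
    moreover have "w \<noteq> 0" using assms by (simp add: w_def)
    ultimately show "g (circlepath 0 R t) / circlepath 0 R t * vector_derivative (circlepath 0 R) (at t) =
        2 * of_real pi * \<i> * g (of_real R * exp (2 * of_real pi * \<i> * of_real t))"
      unfolding w_def[symmetric] by simp
  qed
  then have "((\<lambda>t. 1 / (2 * of_real pi * \<i>) *
        (2 * of_real pi * \<i> * g (of_real R * exp (2 * of_real pi * \<i> * of_real t))))
      has_integral 1 / (2 * of_real pi * \<i>) * (2 * of_real pi * \<i> * g 0)) {0..1}"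
    by (rule has_integral_mult_right)
  moreover have "1 / (2 * of_real pi * \<i>) * (2 * of_real pi * \<i> * z) = z" for z by simp
  ultimately show ?thesis by simp
qed

text \<open>The mean over the full circle, folded at the real axis: each point of the upper half is
  paired with its conjugate. The angle is \<open>l * L\<close>, which turns the half circle into the
  interval from 0 to pi / L; for \<open>L = ln Q\<close> its endpoint is \<tau>/2.\<close>

lemma has_integral_half_circle_mean:
  fixes g :: "complex \<Rightarrow> complex"
  assumes "R > 0" "L > 0" "continuous_on (cball 0 R) g" "g holomorphic_on ball 0 R"
  shows "((\<lambda>l. g (of_real R * cis (l * L)) + g (of_real R * cis (- (l * L))))
    has_integral of_real (2 * pi / L) * g 0) {0..pi / L}"
proof -
  define F where "F = (\<lambda>t. g (of_real R * exp (2 * of_real pi * \<i> * of_real t)))"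
  have F: "(F has_integral g 0) {0..1}"
    unfolding F_def by (rule has_integral_circle_mean[OF assms(1,3,4)])
  have int: "F integrable_on {0..1/2}" "F integrable_on {1/2..1}"
    using F integrable_subinterval_real[of F 0 1] by (auto simp: integrable_on_def)
  have sum: "integral {0..1/2} F + integral {1/2..1} F = g 0"
    using Henstock_Kurzweil_Integration.integral_combine[of 0 "1/2" 1 F] F
    by (simp add: has_integral_iff)
  have "((\<lambda>t. F (-1 * t + 1)) has_integral (1 / \<bar>-1\<bar>) *\<^sub>R integral {1/2..1} F)
      ((\<lambda>t. 1 / -1 * t + - (1 / -1 * 1)) ` {1/2..1::real})"
    using has_integral_affinity[of F "integral {1/2..1} F" "1/2" 1 "-1" 1] int(2)
    by (simp add: integrable_integral del: mult_minus1)
  moreover have "(\<lambda>t. 1 / -1 * t + - (1 / -1 * 1)) ` {1/2..1} = {0..1/2::real}"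
    by (auto simp: image_iff intro!: bexI[of _ "1 - _"])
  ultimately have "((\<lambda>t. F (1 - t)) has_integral integral {1/2..1} F) {0..1/2}" by simp
  then have int': "((\<lambda>t. F t + F (1 - t)) has_integral g 0) {0..1/2}"
    using has_integral_add[OF integrable_integral[OF int(1)]] unfolding sum[symmetric] by blast
  then have *: "((\<lambda>l. F (L / (2 * pi) * l) + F (1 - L / (2 * pi) * l)) has_integral
      (2 * pi / L) *\<^sub>R g 0) {0..pi / L}"
  proof -
    have "(\<lambda>x. 1 / (L / (2 * pi)) * x + - (1 / (L / (2 * pi)) * 0)) ` {0..1/2} = (*) (2 * pi / L) ` {0..1/2}"
      by (intro image_cong) auto
    also have "\<dots> = {0..pi / L}" using assms(2) by (subst image_mult_atLeastAtMost) auto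
    finally show ?thesis
      using has_integral_affinity[of "\<lambda>t. F t + F (1 - t)" "g 0" 0 "1/2" "L / (2 * pi)" 0] assms(2) int' by simp
  qed
  have "F (L / (2 * pi) * l) = g (of_real R * cis (l * L))"
    "F (1 - L / (2 * pi) * l) = g (of_real R * cis (- (l * L)))" for l
  proof -
    have "2 * complex_of_real pi * \<i> * of_real (L / (2 * pi) * l) = \<i> * of_real (l * L)" by simp
    then show "F (L / (2 * pi) * l) = g (of_real R * cis (l * L))"
      unfolding F_def cis_conv_exp by presburger
    have "2 * complex_of_real pi * \<i> * of_real (1 - L / (2 * pi) * l) =
        2 * of_real pi * \<i> + \<i> * of_real (- (l * L))" by (simp add: algebra_simps)
    then have "exp (2 * complex_of_real pi * \<i> * of_real (1 - L / (2 * pi) * l)) =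
        exp (\<i> * of_real (- (l * L)))" by (simp only: exp_add exp_two_pi_i mult_1)
    then show "F (1 - L / (2 * pi) * l) = g (of_real R * cis (- (l * L)))"
      unfolding F_def cis_conv_exp by simp
  qed
  then show ?thesis using * by (simp add: scaleR_conv_of_real)
qed

section \<open>The c-function and the Plancherel density\<close>

lemma c_fun_eq:
  fixes k r :: nat and l :: real
  assumes "2 \<le> k" "2 \<le> r"
  defines "Q \<equiv> real ((r - 1) * (k - 1))"
  defines "u \<equiv> of_real (1 / sqrt Q) * cis (- (l * ln Q))" and "v \<equiv> of_real (1 / sqrt Q) * cis (l * ln Q)"
  shows "c_fun k r (of_real l) = of_real (Q / (real r * real (k - 1))) *
    ((1 - u) * (1 + of_nat (k - 1) * u)) * v / (v - u)"
proof -
  have "(r - 1) * (k - 1) > 0" using assms by simp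
  then have Qpos: "Q > 0" unfolding Q_def by linarith
  define S e m where "S = complex_of_real (sqrt Q)" and "e = cis (l * ln Q)"
    and "m = (of_nat (k - 1) :: complex)"
  have S0: "S \<noteq> 0" and e0: "e \<noteq> 0" and m0: "m \<noteq> 0" using Qpos assms by (auto simp: S_def e_def m_def)
  have S2: "complex_of_real Q = S * S"
    unfolding S_def of_real_mult[symmetric] using Qpos by simp
  have pw: "complex_of_real Q powr z = exp (z * of_real (ln Q))" for z
    using Qpos by (simp add: powr_def Ln_of_real)
  have pwm: "complex_of_real Q powr (- z) = 1 / complex_of_real Q powr z" for z
    unfolding pw by (simp add: exp_minus divide_inverse)
  have eexp: "e = exp (\<i> * of_real (l * ln Q))" by (simp add: e_def cis_conv_exp)
  have Sexp: "S = exp (1 / 2 * of_real (ln Q))"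
  proof -
    have "sqrt Q = exp (1 / 2 * ln Q)" using Qpos by (simp add: powr_half_sqrt[symmetric] powr_def)
    then show ?thesis unfolding S_def by (simp add: exp_of_real[symmetric])
  qed
  have p1: "complex_of_real Q powr (1/2) = S" unfolding pw Sexp by simp
  have p2: "complex_of_real Q powr (1/2 + \<i> * of_real l) = S * e"
    unfolding pw Sexp eexp exp_add[symmetric] by (simp add: algebra_simps)
  have p3: "complex_of_real Q powr (- 1/2 - \<i> * of_real l) = 1 / (S * e)"
    using pwm[of "1/2 + \<i> * of_real l"] p2 by simp
  have p4: "complex_of_real Q powr (\<i> * of_real l) = e" unfolding pw eexp by (simp add: mult.assoc)
  have p5: "complex_of_real Q powr (- \<i> * of_real l) = 1 / e"
    using pwm[of "\<i> * of_real l"] p4 by simp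
  have u: "u = 1 / (S * e)" and v: "v = e / S"
  proof -
    have "cis (- (l * ln Q)) = inverse e" unfolding e_def by (rule cis_inverse[symmetric])
    then show "u = 1 / (S * e)" unfolding u_def S_def by (simp add: divide_inverse)
    show "v = e / S" unfolding v_def S_def e_def by (simp add: divide_inverse)
  qed
  have km: "of_nat k - 1 = m" "of_nat k - 2 = m - 1"
    using assms by (simp_all add: m_def of_nat_diff)
  have c: "c_fun k r (of_real l) = S / (of_nat r * m) * ((S * e - m * (1 / (S * e)) + (m - 1)) / (e - 1 / e))"
    unfolding c_fun_def Let_def Q_def[symmetric] p1 p2 p3 p4 p5 km ..
  have \<kappa>: "complex_of_real (Q / (real r * real (k - 1))) = S * S / (of_nat r * m)"
    unfolding m_def by (simp add: S2)
  have r0: "(of_nat r :: complex) \<noteq> 0" using assms by simp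
  \<comment> \<open>At the poles of \<open>c_fun\<close> both differences vanish, and both sides of
    the claim are 0 by division by zero.\<close>
  have vu: "v - u = (e - 1 / e) / S" unfolding u v using S0 e0 by (simp add: field_simps)
  \<comment> \<open>Since \<open>S * S * v = S * e\<close> is the inverse of \<open>u\<close>,
    multiplying out the product on the left gives the three terms of the numerator of
    \<open>c_fun\<close>.\<close>
  have "S * S * ((1 - u) * (1 + m * u)) * v = (S * e - m * (1 / (S * e)) + (m - 1))"
    unfolding u v using S0 e0 by (simp add: field_simps)
  then have "S * S / (of_nat r * m) * ((1 - u) * (1 + m * u)) * v / (v - u) =
     (S * e - m * (1 / (S * e)) + (m - 1)) / (of_nat r * m) / ((e - 1 / e) / S)"
    unfolding vu by (simp add: times_divide_eq_left)
  then show ?thesis unfolding c \<kappa> m_def[symmetric] by simp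
qed

text \<open>On the circle of radius 1 / sqrt Q, 1 - Q w^2 equals (v - w) / v for the conjugate point
  v. So \<open>h\<close> is \<kappa> / c as a function of \<open>u\<close>, continued into the disc.
  The zero 1 of the denominator is outside because Q > 1.\<close>

lemma regularised_density:
  fixes k r :: nat
  assumes "2 \<le> k" "k \<le> r"
  defines "Q \<equiv> real ((r - 1) * (k - 1))"
  assumes "Q > 1"
  obtains h :: "complex \<Rightarrow> complex" where "continuous_on (cball 0 (1 / sqrt Q)) h"
    "h holomorphic_on ball 0 (1 / sqrt Q)" "h 0 = 1"
    "\<And>w. w \<in> cball 0 (1 / sqrt Q) \<Longrightarrow>
      h w * ((1 - w) * (1 + of_nat (k - 1) * w)) = 1 - of_real Q * w\<^sup>2"
proof -
  define m where "m = real (k - 1)"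
  have m1: "m \<ge> 1" using assms by (simp add: m_def)
  have R1: "1 / sqrt Q < 1" using assms by simp
  have nz1: "1 - w \<noteq> 0" if "w \<in> cball 0 (1 / sqrt Q)" for w :: complex
    using that R1 by auto
  show thesis
  proof (cases "k = r")
    case True
    have Q: "Q = m\<^sup>2" unfolding Q_def m_def True by (simp add: power2_eq_square)
    have "continuous_on (cball 0 (1 / sqrt Q)) (\<lambda>w. (1 - of_real m * w) / (1 - w) :: complex)"
      by (intro continuous_intros ballI nz1)
    moreover have "(\<lambda>w. (1 - of_real m * w) / (1 - w) :: complex) holomorphic_on ball 0 (1 / sqrt Q)"
      by (intro holomorphic_intros nz1) auto
    moreover have "(1 - of_real m * w) / (1 - w) * ((1 - w) * (1 + of_nat (k - 1) * w)) = 1 - of_real Q * w\<^sup>2"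
      if "w \<in> cball 0 (1 / sqrt Q)" for w :: complex
    proof -
      have "(1 - of_real m * w) / (1 - w) * ((1 - w) * (1 + of_nat (k - 1) * w)) =
          (1 - of_real m * w) * (1 + of_real m * w)" using nz1[OF that] by (simp add: m_def)
      then show ?thesis unfolding Q by (simp add: power2_eq_square algebra_simps)
    qed
    ultimately show thesis using that[of "\<lambda>w. (1 - of_real m * w) / (1 - w)"] by simp
  next
    case False
    have nz2: "1 + of_real m * w \<noteq> 0" if "w \<in> cball 0 (1 / sqrt Q)" for w :: complex
    proof
      assume "1 + of_real m * w = 0"
      then have "of_real m * w = -1" by (simp only: add_eq_0_iff)
      then have "cmod (of_real m * w) = 1" by simp
      then have "m * cmod w = 1" using m1 by (simp add: norm_mult)
      moreover have "m * cmod w \<le> m * (1 / sqrt Q)" using that m1 by (intro mult_left_mono) auto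
      moreover have "0 < sqrt Q" using assms(4) by simp
      \<comment> \<open>For \<open>k < r\<close> the zero -1/m of the denominator is strictly
        outside the disc.\<close>
      moreover have "m < sqrt Q"
      proof (rule real_less_rsqrt)
        have "(k - 1) * (k - 1) < (r - 1) * (k - 1)" using assms False by (intro mult_strict_right_mono) auto
        then show "m\<^sup>2 < Q" unfolding m_def Q_def power2_eq_square of_nat_mult[symmetric] of_nat_less_iff .
      qed
      ultimately show False using m1 by (simp add: field_simps)
    qed
    let ?h = "\<lambda>w :: complex. (1 - of_real Q * w\<^sup>2) / ((1 - w) * (1 + of_real m * w))"
    have "continuous_on (cball 0 (1 / sqrt Q)) ?h"
      by (intro continuous_intros ballI no_zero_divisors nz1 nz2)
    moreover have "?h holomorphic_on ball 0 (1 / sqrt Q)"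
      by (intro holomorphic_intros no_zero_divisors nz1 nz2) auto
    moreover have "?h w * ((1 - w) * (1 + of_nat (k - 1) * w)) = 1 - of_real Q * w\<^sup>2"
      if "w \<in> cball 0 (1 / sqrt Q)" for w :: complex
      using nz1[OF that] nz2[OF that] by (simp add: m_def)
    ultimately show thesis using that[of ?h] by simp
  qed
qed

text \<open>By the closed form and \<open>C + cnj C = 1\<close>, the density is
  \<open>u ^ n / C + v ^ n / cnj C\<close>, which is g(u) + g(v) for a single function
  \<open>g\<close> holomorphic in the disc. The half-circle mean gives g(0), and the constant
  \<open>\<kappa> * (L / (2 * pi))\<close> normalises it.\<close>

lemma spherical_plancherel:
  fixes k r n :: nat
  assumes kr: "2 \<le> k" "k \<le> r"
  defines "Q \<equiv> real ((r - 1) * (k - 1))"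
  assumes Q1: "Q > 1"
  defines "u \<equiv> \<lambda>l. of_real (1 / sqrt Q) * cis (- (l * ln Q))" and "v \<equiv> \<lambda>l. of_real (1 / sqrt Q) * cis (l * ln Q)"
  defines "D \<equiv> \<lambda>l. spherical (of_real (Q / (real r * real (k - 1)))) (of_nat (k - 1)) (u l) (v l) n *
      of_real (cmod (c_fun k r (of_real l)) powi (- 2))"
  shows "set_integrable lborel {0..pi / ln Q} D"
    and "of_real (1 / (2 * pi) * (Q * ln Q / (real r * real (k - 1)))) *
      (LINT l:{0..pi / ln Q}|lborel. D l) = (if n = 0 then 1 else 0)"
proof -
  define L where "L = ln Q"
  have L: "L > 0" using Q1 by (simp add: L_def)
  define \<kappa> where "\<kappa> = Q / (real r * real (k - 1))"
  have \<kappa>: "\<kappa> > 0" unfolding \<kappa>_def using kr Q1 by (intro divide_pos_pos mult_pos_pos) auto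
  define R where "R = 1 / sqrt Q"
  have R: "R > 0" "R * R = 1 / Q" using Q1 by (auto simp: R_def)
  define m where "m = real (k - 1)"
  obtain h where h: "continuous_on (cball 0 R) h" "h holomorphic_on ball 0 R" "h 0 = 1"
    "\<And>w. w \<in> cball 0 R \<Longrightarrow> h w * ((1 - w) * (1 + of_real m * w)) = 1 - of_real Q * w\<^sup>2"
    using regularised_density[OF kr] Q1 unfolding Q_def R_def m_def by (metis of_real_of_nat_eq)
  define g where "g = (\<lambda>w. w ^ n * h w / of_real \<kappa>)"
  define G where "G = (\<lambda>l. g (of_real R * cis (l * L)) + g (of_real R * cis (- (l * L))))"
  have uv: "u l = of_real R * cis (- (l * L))" "v l = of_real R * cis (l * L)" for l
    by (simp_all add: u_def v_def R_def L_def)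
  have gc: "continuous_on (cball 0 R) g" unfolding g_def using h(1) \<kappa> by (intro continuous_intros) auto
  have gh: "g holomorphic_on ball 0 R" unfolding g_def using h(2) \<kappa> by (intro holomorphic_intros) auto
  have g0: "g 0 = (if n = 0 then 1 / of_real \<kappa> else 0)" by (simp add: g_def h(3))
  have in_ball: "u l \<in> cball 0 R" "v l \<in> cball 0 R" for l
    using R by (auto simp: uv norm_mult)
  have Gc: "continuous_on {0..pi / L} G"
    unfolding G_def using in_ball uv
    by (intro continuous_on_add continuous_on_compose2[OF gc] continuous_intros) auto
  have Gi: "(G has_integral of_real (2 * pi / L) * g 0) {0..pi / L}"
    unfolding G_def by (rule has_integral_half_circle_mean[OF R(1) L gc gh])
  have c: "c_fun k r (of_real l) = of_real \<kappa> * ((1 - u l) * (1 + of_real m * u l)) * v l / (v l - u l)" for l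
    using c_fun_eq[of k r l] kr unfolding Q_def u_def v_def \<kappa>_def m_def by simp
  have prod: "u l * v l = of_real (1 / Q)" for l
  proof -
    have "u l * v l = of_real (R * R) * (cis (- (l * L)) * cis (l * L))" unfolding uv by simp
    then show ?thesis unfolding R(2) by (simp add: cis_mult)
  qed
  have cnj_uv: "cnj (u l) = v l" "cnj (v l) = u l" for l by (simp_all add: uv cis_cnj)
  \<comment> \<open>At the endpoints \<open>u l = v l\<close>, so \<open>c_fun\<close> is 0 by
    division by zero, and so is its power with exponent -2. Thus \<open>D\<close> is compared with
    \<open>G\<close> only on the open interval.\<close>
  have D0: "D l = 0" if "l = 0 \<or> l = pi / L" for l
  proof -
    have "u l = v l" using that L by (auto simp: uv complex_eq_iff)
    then show ?thesis using c[of l] by (simp add: D_def)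
  qed
  have DG: "D l = G l" if l: "l \<in> {0<..<pi / L}" for l
  proof -
    have "0 < l * L" "l * L < pi" using l L by (auto simp: field_simps)
    then have "sin (l * L) > 0" by (rule sin_gt_zero)
    then have im: "Im (u l) < 0" "Im (v l) > 0" using R by (simp_all add: uv)
    then have nz: "u l \<noteq> v l" "1 - u l \<noteq> 0" "1 - v l \<noteq> 0" by (auto simp: complex_eq_iff)
    have m: "m \<ge> 1" using kr by (simp add: m_def)
    have nz2: "1 + of_real m * u l \<noteq> 0" "1 + of_real m * v l \<noteq> 0" using im m
      by (auto simp: complex_eq_iff)
    have nz3: "u l \<noteq> 0" "v l \<noteq> 0" using im by auto
    define C where "C = c_fun k r (of_real l)"
    have C: "C * (v l - u l) = of_real \<kappa> * ((1 - u l) * (1 + of_real m * u l)) * v l"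
      unfolding C_def c using nz by simp
    have C': "cnj C * (u l - v l) = of_real \<kappa> * ((1 - v l) * (1 + of_real m * v l)) * u l"
      using arg_cong[OF C, of cnj] by (simp add: cnj_uv)
    have Cnz: "C \<noteq> 0" using C nz nz2 nz3 \<kappa> by auto
    have Q0: "complex_of_real Q \<noteq> 0" using Q1 by simp
    \<comment> \<open>Used for \<open>C\<close> at \<open>w = u l\<close> and for
      \<open>cnj C\<close> at \<open>w = v l\<close>. From w w' = 1/Q, the factor 1 - Q w^2 times w'
      becomes w' - w, which identifies \<open>E * h w\<close> with \<open>\<kappa>\<close>.\<close>
    have half: "w ^ n / E = g w"
      if "w \<in> cball 0 R" "w * w' = of_real (1 / Q)" "1 - w \<noteq> 0" "1 + of_real m * w \<noteq> 0" "E \<noteq> 0"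
        "E * (w' - w) = of_real \<kappa> * ((1 - w) * (1 + of_real m * w)) * w'" for w w' E
    proof -
      have "w' \<noteq> 0" using that(2) Q1 by auto
      have 1: "of_real Q * w * w' = 1" using that(2) Q0 by (simp add: mult.assoc)
      have "h w * ((1 - w) * (1 + of_real m * w)) * w' = (1 - of_real Q * w\<^sup>2) * w'"
        using h(4)[OF that(1)] by simp
      also have "\<dots> = w' - of_real Q * w * w' * w" by (simp add: algebra_simps power2_eq_square)
      also have "\<dots> = w' - w" unfolding 1 by simp
      finally have "E * h w * ((1 - w) * (1 + of_real m * w)) * w' = E * (w' - w)" by (simp add: mult.assoc)
      also note that(6)
      finally have "(E * h w) * (((1 - w) * (1 + of_real m * w)) * w') =
          of_real \<kappa> * (((1 - w) * (1 + of_real m * w)) * w')" by (simp add: mult.assoc)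
      then have "E * h w = of_real \<kappa>" using that(3,4) \<open>w' \<noteq> 0\<close> by simp
      then have "1 / E = h w / of_real \<kappa>" using that(5) \<kappa> by (simp add: field_simps)
      then show ?thesis unfolding g_def by (metis times_divide_eq_right mult.right_neutral)
    qed
    have gu: "u l ^ n / C = g (u l)"
      by (rule half[where w' = "v l"]) (use in_ball prod nz nz2 Cnz C in auto)
    have gv: "v l ^ n / cnj C = g (v l)"
      by (rule half[where w' = "u l"])
        (use in_ball prod[of l] nz nz2 Cnz C' in \<open>auto simp: mult.commute[of "v l" "u l"]\<close>)
    \<comment> \<open>Behind this identity is Q + (k - 1) = r (k - 1).\<close>
    have sumC: "C + cnj C = 1"
    proof -
      have "(C + cnj C) * (v l - u l) = C * (v l - u l) - cnj C * (u l - v l)" by (simp add: algebra_simps)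
      also have "\<dots> = of_real \<kappa> * ((1 - u l) * (1 + of_real m * u l) * v l - (1 - v l) * (1 + of_real m * v l) * u l)"
        unfolding C C' by (simp add: algebra_simps)
      also have "\<dots> = of_real \<kappa> * ((v l - u l) * (1 + of_real m * (u l * v l)))" by (simp add: algebra_simps)
      also have "\<dots> = of_real \<kappa> * (1 + of_real m * of_real (1 / Q)) * (v l - u l)"
        unfolding prod by simp
      also have "of_real \<kappa> * (1 + of_real m * of_real (1 / Q)) = complex_of_real (\<kappa> * (1 + m / Q))" by simp
      also have "\<kappa> * (1 + m / Q) = 1"
      proof -
        have "Q + m = real r * m" using kr unfolding Q_def m_def of_nat_mult
          by (subst of_nat_diff[of 1 r]) (auto simp: algebra_simps)
        then show ?thesis using Q1 m kr unfolding \<kappa>_def m_def[symmetric] by (simp add: field_simps)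
      qed
      finally show ?thesis using nz by simp
    qed
    have "of_real (cmod C powi (- 2)) = 1 / (C * cnj C)"
      by (simp add: power_int_minus complex_norm_square[symmetric] divide_inverse power2_eq_square)
    then have "D l = (C * v l ^ n + (1 - C) * u l ^ n) * (1 / (C * cnj C))"
      unfolding D_def C_def[symmetric] \<kappa>_def[symmetric]
      using spherical_closed_form[of "u l" "v l" C "of_real \<kappa>" "of_real m" n] nz c[of l]
      by (simp add: C_def m_def)
    also have "1 - C = cnj C" using sumC by (metis add_diff_cancel_left')
    also have "(C * v l ^ n + cnj C * u l ^ n) * (1 / (C * cnj C)) = v l ^ n / cnj C + u l ^ n / C"
      using Cnz by (simp add: field_simps)
    finally show ?thesis unfolding gu gv unfolding G_def uv .
  qed
  have ind: "indicator {0..pi / L} l *\<^sub>R D l = indicator {0<..<pi / L} l *\<^sub>R G l" for l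
  proof (cases "l = 0 \<or> l = pi / L")
    case True
    then show ?thesis using D0[OF True] by auto
  next
    case False
    then have "l \<in> {0..pi / L} \<longleftrightarrow> l \<in> {0<..<pi / L}" by auto
    then show ?thesis using DG[of l] by (cases "l \<in> {0<..<pi / L}") auto
  qed
  have "set_integrable lborel {0..pi / L} G" by (rule borel_integrable_atLeastAtMost'[OF Gc])
  then have Gset: "set_integrable lborel {0<..<pi / L} G"
    by (rule set_integrable_subset) auto
  then show "set_integrable lborel {0..pi / ln Q} D"
    unfolding set_integrable_def L_def[symmetric] ind .
  have "(LINT l:{0..pi / L}|lborel. D l) = (LINT l:{0<..<pi / L}|lborel. G l)"
    unfolding set_lebesgue_integral_def ind ..
  also have "\<dots> = integral {0<..<pi / L} G" by (rule set_borel_integral_eq_integral(2)[OF Gset])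
  also have "\<dots> = integral {0..pi / L} G" using integral_open_interval[of 0 "pi / L" G] by (simp add: box_real)
  also have "\<dots> = of_real (2 * pi / L) * g 0" using Gi by (rule integral_unique)
  finally have "(LINT l:{0..pi / L}|lborel. D l) = of_real (2 * pi / L) * g 0" .
  moreover have "1 / (2 * pi) * (Q * ln Q / (real r * real (k - 1))) = \<kappa> * (L / (2 * pi))"
    by (simp add: \<kappa>_def L_def)
  moreover have "complex_of_real (\<kappa> * (L / (2 * pi))) * (of_real (2 * pi / L) * g 0) = (if n = 0 then 1 else 0)"
    unfolding g0 using L \<kappa> by auto
  ultimately show "of_real (1 / (2 * pi) * (Q * ln Q / (real r * real (k - 1)))) *
      (LINT l:{0..pi / ln Q}|lborel. D l) = (if n = 0 then 1 else 0)"
    unfolding L_def[symmetric] by metis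
qed

section \<open>Trees of blocks\<close>

text \<open>Isolates the geometry that the sums over spheres use: \<open>B\<close> will be the
  family of vertex sets of the polygons and \<open>d\<close> the distance counted in polygons.
  \<open>gate_exists\<close> and \<open>block_towards\<close> express the tree structure.\<close>

locale block_tree =
  fixes k r :: nat and V :: "'v set" and B :: "'v set set" and d :: "'v \<Rightarrow> 'v \<Rightarrow> nat"
  assumes k_ge_2: "2 \<le> k" and r_ge_2: "2 \<le> r"
    and block_subset: "T \<in> B \<Longrightarrow> T \<subseteq> V"
    and card_block: "T \<in> B \<Longrightarrow> card T = k"
    and card_blocks_at: "x \<in> V \<Longrightarrow> card {T \<in> B. x \<in> T} = r"
    and blocks_meet: "S \<in> B \<Longrightarrow> T \<in> B \<Longrightarrow> S \<noteq> T \<Longrightarrow> x \<in> S \<Longrightarrow> x \<in> T \<Longrightarrow> S \<inter> T = {x}"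
    and d_eq_0_iff: "x \<in> V \<Longrightarrow> y \<in> V \<Longrightarrow> d x y = 0 \<longleftrightarrow> x = y"
    and d_commute: "x \<in> V \<Longrightarrow> y \<in> V \<Longrightarrow> d x y = d y x"
    and gate_exists: "T \<in> B \<Longrightarrow> z \<in> V \<Longrightarrow> \<exists>g\<in>T. \<forall>w\<in>T - {g}. d w z = Suc (d g z)"
    and block_towards: "x \<in> V \<Longrightarrow> z \<in> V \<Longrightarrow> x \<noteq> z \<Longrightarrow>
      \<exists>!T. T \<in> B \<and> x \<in> T \<and> (\<exists>w\<in>T. d w z < d x z)"
begin

section \<open>Gates and geodesics\<close>

definition gate :: "'v set \<Rightarrow> 'v \<Rightarrow> 'v" where
  "gate T z = (SOME g. g \<in> T \<and> (\<forall>w\<in>T - {g}. d w z = Suc (d g z)))"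

lemma gate_in: "T \<in> B \<Longrightarrow> z \<in> V \<Longrightarrow> gate T z \<in> T"
  and d_gate: "T \<in> B \<Longrightarrow> z \<in> V \<Longrightarrow> w \<in> T \<Longrightarrow> w \<noteq> gate T z \<Longrightarrow> d w z = Suc (d (gate T z) z)"
proof -
  assume "T \<in> B" "z \<in> V"
  then have *: "gate T z \<in> T \<and> (\<forall>w\<in>T - {gate T z}. d w z = Suc (d (gate T z) z))"
    unfolding gate_def
    using someI_ex[of "\<lambda>g. g \<in> T \<and> (\<forall>w\<in>T - {g}. d w z = Suc (d g z))"] gate_exists[of T z]
    by blast
  then show "gate T z \<in> T" by blast
  show "d w z = Suc (d (gate T z) z)" if "w \<in> T" "w \<noteq> gate T z" using * that by blast
qed

text \<open>Translates between two ways to say that a block leads from \<open>x\<close> towards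
  \<open>z\<close>, so that \<open>block_towards\<close> can be used through \<open>gate\<close>
  alone.\<close>

lemma gate_neq_iff:
  assumes "T \<in> B" "z \<in> V" "x \<in> T"
  shows "gate T z \<noteq> x \<longleftrightarrow> (\<exists>w\<in>T. d w z < d x z)"
proof
  assume "gate T z \<noteq> x"
  then show "\<exists>w\<in>T. d w z < d x z" using d_gate[of T z x] gate_in[of T z] assms by auto
next
  assume "\<exists>w\<in>T. d w z < d x z"
  then obtain w where w: "w \<in> T" "d w z < d x z" by blast
  then show "gate T z \<noteq> x" using d_gate[of T z w] assms by (cases "w = gate T z") auto
qed

lemma gate_self: "T \<in> B \<Longrightarrow> x \<in> T \<Longrightarrow> gate T x = x"
  using gate_neq_iff[of T x x] block_subset[of T] d_eq_0_iff[of x x] by auto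

lemma gate_neq_exists:
  assumes "x \<in> V" "z \<in> V" "x \<noteq> z"
  obtains T where "T \<in> B" "x \<in> T" "gate T z \<noteq> x"
proof -
  obtain T where "T \<in> B" "x \<in> T" "\<exists>w\<in>T. d w z < d x z"
    using block_towards[OF assms] by blast
  then show thesis using that gate_neq_iff[of T z x] assms by blast
qed

text \<open>Uniqueness in \<open>block_towards\<close>: the branches hanging off \<open>x\<close>
  behind distinct blocks are disjoint, which makes sums over branches additive.\<close>

lemma gate_neq_unique:
  assumes "S \<in> B" "T \<in> B" "x \<in> S" "x \<in> T" "z \<in> V" "gate S z \<noteq> x" "gate T z \<noteq> x"
  shows "S = T"
proof -
  have "x \<in> V" using assms block_subset by blast
  moreover have "x \<noteq> z" using assms gate_self by blast
  ultimately show ?thesis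
    using ex1_implies_ex[OF block_towards[of x z]] block_towards[of x z]
      gate_neq_iff[of S z x] gate_neq_iff[of T z x] assms by blast
qed

lemma d_block_le: "T \<in> B \<Longrightarrow> x \<in> T \<Longrightarrow> y \<in> T \<Longrightarrow> z \<in> V \<Longrightarrow> d x z \<le> Suc (d y z)"
  using d_gate[of T z x] d_gate[of T z y] by (cases "x = gate T z"; cases "y = gate T z") auto

text \<open>Induction along the geodesic from \<open>w\<close> to \<open>z\<close>: at each vertex the block leading on to \<open>z\<close>
  differs from the block leading back to \<open>a\<close>.\<close>
lemma d_through_gate:
  assumes "T \<in> B" "a \<in> V" "z \<in> V" "gate T z = w" "gate T a \<noteq> w"
  shows "d a z = d a w + d w z"
  using assms
proof (induction "d w z" arbitrary: T w)
  case 0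
  have "w \<in> V" using 0 gate_in block_subset by blast
  then have "w = z" using 0 d_eq_0_iff by auto
  then show ?case using d_eq_0_iff[of z z] \<open>z \<in> V\<close> by simp
next
  case (Suc n)
  have w: "w \<in> T" "w \<in> V" using Suc gate_in block_subset by blast+
  have "w \<noteq> z" using Suc d_eq_0_iff w by (metis nat.distinct(1))
  then obtain S where S: "S \<in> B" "w \<in> S" "gate S z \<noteq> w"
    using gate_neq_exists w Suc.prems by blast
  define w1 where "w1 = gate S z"
  have w1: "w1 \<in> S" "w1 \<in> V" using S gate_in Suc.prems block_subset unfolding w1_def by blast+
  have dz: "d w z = Suc (d w1 z)" using S d_gate Suc.prems unfolding w1_def by metis
  have "S \<noteq> T" using S Suc.prems by blast
  \<comment> \<open>Only \<open>T\<close> leads from \<open>w\<close> to \<open>a\<close>, so in the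
    other block \<open>S\<close> the gate for \<open>a\<close> is \<open>w\<close> itself.\<close>
  then have gSa: "gate S a = w" using gate_neq_unique[of S T w a] S w Suc.prems by blast
  then have "gate S a \<noteq> w1" using S w1_def by simp
  then have "d a z = d a w1 + d w1 z"
    by (intro Suc.hyps(1)[of w1 S]) (use dz Suc.hyps(2) S Suc.prems w1_def in auto)
  moreover have "d w1 a = Suc (d w a)" using d_gate[of S a w1] S Suc.prems w1(1) gSa \<open>gate S a \<noteq> w1\<close> by simp
  ultimately show ?case using dz d_commute[of w a] d_commute[of w1 a] w(2) w1(2) Suc.prems(2) by simp
qed

lemma finite_block: "T \<in> B \<Longrightarrow> finite T"
  using card_block[of T] k_ge_2 by (intro card_ge_0_finite) simp

lemma finite_blocks_at: "x \<in> V \<Longrightarrow> finite {T \<in> B. x \<in> T}"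
  using card_blocks_at[of x] r_ge_2 by (intro card_ge_0_finite) simp

text \<open>Seen from \<open>w\<close>, any other vertex lies behind exactly one block
  \<open>T\<close> at \<open>w\<close> and, within \<open>T\<close>, behind exactly one vertex
  \<open>v = gate T z\<close>. The family \<open>\<T>\<close> may be smaller than that of all blocks
  at \<open>w\<close>, so that one of them can be left out.\<close>

lemma sum_by_branches:
  fixes F :: "'v \<Rightarrow> 'a :: comm_monoid_add"
  assumes "w \<in> V" "finite A" "A \<subseteq> V" "w \<notin> A" "\<T> \<subseteq> {T \<in> B. w \<in> T}"
  shows "(\<Sum>z | z \<in> A \<and> (\<exists>T\<in>\<T>. gate T z \<noteq> w). F z) =
    (\<Sum>T\<in>\<T>. \<Sum>v\<in>T - {w}. \<Sum>z | z \<in> A \<and> gate T z = v. F z)"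
proof -
  have fin: "finite \<T>" using finite_subset[OF assms(5) finite_blocks_at] assms by blast
  have "{z \<in> A. \<exists>T\<in>\<T>. gate T z \<noteq> w} = (\<Union>T\<in>\<T>. {z \<in> A. gate T z \<noteq> w})" by blast
  also have "sum F \<dots> = (\<Sum>T\<in>\<T>. \<Sum>z | z \<in> A \<and> gate T z \<noteq> w. F z)"
  proof (rule sum.UNION_disjoint[OF fin])
    show "\<forall>T\<in>\<T>. finite {z \<in> A. gate T z \<noteq> w}" using assms by simp
    show "\<forall>S\<in>\<T>. \<forall>T\<in>\<T>. S \<noteq> T \<longrightarrow> {z \<in> A. gate S z \<noteq> w} \<inter> {z \<in> A. gate T z \<noteq> w} = {}"
      using gate_neq_unique[of _ _ w] assms by blast
  qed
  also have "\<dots> = (\<Sum>T\<in>\<T>. \<Sum>v\<in>T - {w}. \<Sum>z | z \<in> A \<and> gate T z = v. F z)"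
  proof (rule sum.cong[OF refl])
    fix T assume T: "T \<in> \<T>"
    have "(\<Sum>v\<in>T - {w}. \<Sum>z | z \<in> {z \<in> A. gate T z \<noteq> w} \<and> gate T z = v. F z) =
        (\<Sum>z | z \<in> A \<and> gate T z \<noteq> w. F z)"
      by (rule sum.group) (use T assms finite_block gate_in in \<open>auto simp: subset_iff\<close>)
    moreover have "{z. z \<in> {z \<in> A. gate T z \<noteq> w} \<and> gate T z = v} = {z. z \<in> A \<and> gate T z = v}"
      if "v \<in> T - {w}" for v using that by auto
    then have "(\<Sum>v\<in>T - {w}. \<Sum>z | z \<in> {z \<in> A. gate T z \<noteq> w} \<and> gate T z = v. F z) =
        (\<Sum>v\<in>T - {w}. \<Sum>z | z \<in> A \<and> gate T z = v. F z)"
      by (intro sum.cong refl) auto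
    ultimately show "(\<Sum>z | z \<in> A \<and> gate T z \<noteq> w. F z) =
        (\<Sum>v\<in>T - {w}. \<Sum>z | z \<in> A \<and> gate T z = v. F z)" by simp
  qed
  finally show ?thesis .
qed

end

section \<open>Spheres around the root and the masses of branches\<close>

locale rooted_block_tree = block_tree +
  fixes b assumes root_in: "b \<in> V"
begin

definition Q :: real where "Q = real ((r - 1) * (k - 1))"

lemma Q_ge_1: "Q \<ge> 1"
proof -
  have "(r - 1) * (k - 1) > 0" using k_ge_2 r_ge_2 by simp
  then have "(r - 1) * (k - 1) \<ge> 1" by linarith
  then show ?thesis unfolding Q_def by (metis of_nat_1 of_nat_le_iff)
qed

definition sphere :: "nat \<Rightarrow> 'a set" where "sphere n = {z \<in> V. d z b = n}"

text \<open>Every vertex of the next sphere shares a block with a vertex of the previous one, namely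
  the gate of this block towards the root; blocks are finite, and so is their number at a
  vertex.\<close>

lemma finite_sphere: "finite (sphere n)"
proof (induction n)
  case 0
  then show ?case unfolding sphere_def using d_eq_0_iff root_in
    by (auto intro: finite_subset[of _ "{b}"])
next
  case (Suc n)
  have "sphere (Suc n) \<subseteq> (\<Union>x\<in>sphere n. \<Union>{T \<in> B. x \<in> T})"
  proof
    fix z assume "z \<in> sphere (Suc n)"
    then have z: "z \<in> V" "d z b = Suc n" by (auto simp: sphere_def)
    then have "z \<noteq> b" using d_eq_0_iff root_in by fastforce
    then obtain T where T: "T \<in> B" "z \<in> T" "gate T b \<noteq> z" using gate_neq_exists z root_in by blast
    have "gate T b \<in> sphere n"
      using d_gate[OF T(1) root_in T(2)] T z gate_in[OF T(1) root_in] block_subset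
      unfolding sphere_def by auto
    then show "z \<in> (\<Union>x\<in>sphere n. \<Union>{T \<in> B. x \<in> T})" using T gate_in root_in by blast
  qed
  moreover have "finite (\<Union>x\<in>sphere n. \<Union>{T \<in> B. x \<in> T})"
    using Suc finite_blocks_at finite_block unfolding sphere_def by auto
  ultimately show ?case by (rule finite_subset)
qed

text \<open>The vertices with gate \<open>w\<close> in \<open>T\<close>, apart from
  \<open>w\<close>, are those reached from \<open>w\<close> through some other block. This is one
  step of the branching recursion.\<close>

lemma sum_gate_unroll:
  fixes F :: "'a \<Rightarrow> real"
  assumes "T \<in> B" "w \<in> T" "finite A" "A \<subseteq> V" "w \<notin> A"
  shows "(\<Sum>z | z \<in> A \<and> gate T z = w. F z) =
    (\<Sum>S\<in>{S \<in> B. w \<in> S} - {T}. \<Sum>v\<in>S - {w}. \<Sum>z | z \<in> A \<and> gate S z = v. F z)"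
proof -
  have "gate T z = w \<longleftrightarrow> (\<exists>S\<in>{S \<in> B. w \<in> S} - {T}. gate S z \<noteq> w)" if "z \<in> A" for z
  proof
    assume "gate T z = w"
    have wz: "w \<in> V" "z \<in> V" "w \<noteq> z" using that assms block_subset by blast+
    obtain S where "S \<in> B" "w \<in> S" "gate S z \<noteq> w" by (rule gate_neq_exists[OF wz])
    then show "\<exists>S\<in>{S \<in> B. w \<in> S} - {T}. gate S z \<noteq> w"
      using \<open>gate T z = w\<close> by blast
  next
    assume "\<exists>S\<in>{S \<in> B. w \<in> S} - {T}. gate S z \<noteq> w"
    then show "gate T z = w" using gate_neq_unique[of _ T w z] that assms by blast
  qed
  then have "{z. z \<in> A \<and> gate T z = w} = {z. z \<in> A \<and> (\<exists>S\<in>{S \<in> B. w \<in> S} - {T}. gate S z \<noteq> w)}"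
    by blast
  moreover have "w \<in> V" using assms block_subset by blast
  ultimately show ?thesis using sum_by_branches[of w A "{S \<in> B. w \<in> S} - {T}" F] assms by auto
qed

text \<open>Up to normalisation, the mass of the ends beyond \<open>w\<close>, as seen from \<open>w\<close>.\<close>
definition branch_flow :: "nat \<Rightarrow> 'a set \<Rightarrow> 'a \<Rightarrow> real" where
  "branch_flow M T w = (\<Sum>z | z \<in> sphere M \<and> gate T z = w. (1 / Q) ^ d w z)"

lemma branch_flow_parent:
  assumes "S \<in> B" "w \<in> S" "v \<in> S" "v \<noteq> w"
  shows "(\<Sum>z | z \<in> sphere M \<and> gate S z = v. (1 / Q) ^ d w z) = 1 / Q * branch_flow M S v"
  unfolding branch_flow_def sum_distrib_left
proof (rule sum.cong[OF refl])
  fix z assume "z \<in> {z \<in> sphere M. gate S z = v}"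
  then have "d w z = Suc (d v z)" using d_gate[of S z w] assms by (auto simp: sphere_def)
  then show "(1 / Q) ^ d w z = 1 / Q * (1 / Q) ^ d v z" by simp
qed

text \<open>Beyond \<open>w\<close> there are r - 1 further blocks with k - 1 further vertices each,
  every one contributing 1/Q, and (r - 1)(k - 1) = Q. Being off the sphere, \<open>w\<close>
  contributes nothing itself.\<close>

lemma branch_flow_step:
  assumes "T \<in> B" "w \<in> T" "d w b \<noteq> M"
    and "\<And>S v. S \<in> B \<Longrightarrow> w \<in> S \<Longrightarrow> S \<noteq> T \<Longrightarrow> v \<in> S \<Longrightarrow> v \<noteq> w \<Longrightarrow> branch_flow M S v = 1"
  shows "branch_flow M T w = 1"
proof -
  have wV: "w \<in> V" using assms block_subset by blast
  have "branch_flow M T w = (\<Sum>S\<in>{S \<in> B. w \<in> S} - {T}. \<Sum>v\<in>S - {w}.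
      \<Sum>z | z \<in> sphere M \<and> gate S z = v. (1 / Q) ^ d w z)"
    unfolding branch_flow_def
    by (rule sum_gate_unroll) (use assms finite_sphere in \<open>auto simp: sphere_def\<close>)
  also have "\<dots> = (\<Sum>S\<in>{S \<in> B. w \<in> S} - {T}. \<Sum>v\<in>S - {w}. 1 / Q)"
    by (intro sum.cong refl) (use assms branch_flow_parent in auto)
  also have "\<dots> = (\<Sum>S\<in>{S \<in> B. w \<in> S} - {T}. real (k - 1) * (1 / Q))"
    by (intro sum.cong refl) (use card_block finite_block in auto)
  also have "\<dots> = real (r - 1) * (real (k - 1) * (1 / Q))"
    using card_blocks_at[OF wV] finite_blocks_at[OF wV] assms by simp
  also have "\<dots> = 1" using Q_ge_1 unfolding Q_def by auto
  finally show ?thesis .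
qed

text \<open>The branch beyond \<open>w\<close> points away from the root and can be followed
  outwards until it meets the sphere; hence the induction on \<open>M - d w b\<close>.\<close>

lemma branch_flow_outward:
  assumes "T \<in> B" "w \<in> T" "gate T b \<noteq> w" "d w b \<le> M"
  shows "branch_flow M T w = 1"
  using assms
proof (induction "M - d w b" arbitrary: T w)
  case 0
  have wV: "w \<in> V" using 0 block_subset by blast
  \<comment> \<open>Once \<open>w\<close> is on the sphere, any other vertex of the branch is
    farther from the root, so only \<open>w\<close> counts, with weight 1.\<close>
  have "z = w" if "z \<in> sphere M" "gate T z = w" for z
    using d_through_gate[of T b z w] that 0 root_in wV d_eq_0_iff[of w z] d_commute
    by (auto simp: sphere_def)
  moreover have "w \<in> sphere M" using 0 wV by (auto simp: sphere_def)
  ultimately have "{z. z \<in> sphere M \<and> gate T z = w} = {w}" using gate_self 0 by auto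
  then show ?case unfolding branch_flow_def using d_eq_0_iff[of w w] wV by simp
next
  case (Suc n)
  show ?case
  proof (rule branch_flow_step)
    fix S v assume S: "S \<in> B" "w \<in> S" "S \<noteq> T" "v \<in> S" "v \<noteq> w"
    have g: "gate S b = w" using gate_neq_unique[of S T w b] S Suc.prems root_in by blast
    then have "d v b = Suc (d w b)" using d_gate[of S b v] S root_in by simp
    then show "branch_flow M S v = 1" using Suc.hyps(1)[of v S] Suc.hyps(2) S g by simp
  qed (use Suc in auto)
qed

text \<open>Now the branch may contain the root. Of the next vertices, one that is the gate towards
  the root is nearer to it and falls under the induction; the others start outward branches. The
  strict bound keeps these within distance \<open>M\<close>.\<close>

lemma branch_flow_eq_1:
  assumes "T \<in> B" "w \<in> T" "d w b < M"
  shows "branch_flow M T w = 1"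
  using assms
proof (induction "d w b" arbitrary: T w rule: less_induct)
  case less
  show ?case
  proof (rule branch_flow_step)
    fix S v assume S: "S \<in> B" "w \<in> S" "S \<noteq> T" "v \<in> S" "v \<noteq> w"
    show "branch_flow M S v = 1"
    proof (cases "gate S b = v")
      case True
      then have "d w b = Suc (d v b)" using d_gate[of S b w] S root_in by simp
      then show ?thesis using less S by simp
    next
      case False
      moreover have "d v b \<le> M" using d_block_le[of S v w b] S root_in less by simp
      ultimately show ?thesis using branch_flow_outward S by blast
    qed
  qed (use less in auto)
qed

text \<open>From an inner vertex the whole sphere splits into r (k - 1) branches, each of mass 1/Q
  as seen from \<open>y\<close>.\<close>

lemma sum_sphere_flow:
  assumes "y \<in> V" "d y b < M"
  shows "(\<Sum>z\<in>sphere M. (1 / Q) ^ d y z) = real r * real (k - 1) / Q"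
proof -
  have "sphere M = {z. z \<in> sphere M \<and> (\<exists>T\<in>{T \<in> B. y \<in> T}. gate T z \<noteq> y)}"
    using gate_neq_exists[of y] assms unfolding sphere_def by blast
  then have "(\<Sum>z\<in>sphere M. (1 / Q) ^ d y z) =
      (\<Sum>z | z \<in> sphere M \<and> (\<exists>T\<in>{T \<in> B. y \<in> T}. gate T z \<noteq> y). (1 / Q) ^ d y z)" by simp
  also have "\<dots> = (\<Sum>T\<in>{T \<in> B. y \<in> T}. \<Sum>v\<in>T - {y}. \<Sum>z | z \<in> sphere M \<and> gate T z = v. (1 / Q) ^ d y z)"
    by (rule sum_by_branches) (use assms finite_sphere in \<open>auto simp: sphere_def\<close>)
  also have "\<dots> = (\<Sum>T\<in>{T \<in> B. y \<in> T}. \<Sum>v\<in>T - {y}. 1 / Q)"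
  proof (intro sum.cong refl)
    fix T v assume *: "T \<in> {T \<in> B. y \<in> T}" "v \<in> T - {y}"
    have "branch_flow M T v = 1"
    proof (cases "gate T b = v")
      case True
      then have "d y b = Suc (d v b)" using d_gate[of T b y] * root_in by auto
      then show ?thesis using branch_flow_eq_1[of T v M] * assms by simp
    next
      case False
      moreover have "d v b \<le> M" using d_block_le[of T v y b] * root_in assms by simp
      ultimately show ?thesis using branch_flow_outward[of T v M] * by blast
    qed
    then show "(\<Sum>z | z \<in> sphere M \<and> gate T z = v. (1 / Q) ^ d y z) = 1 / Q"
      using branch_flow_parent[of T y v M] * by simp
  qed
  also have "\<dots> = (\<Sum>T\<in>{T \<in> B. y \<in> T}. real (k - 1) * (1 / Q))"
    by (intro sum.cong refl) (use card_block finite_block in auto)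
  also have "\<dots> = real r * (real (k - 1) * (1 / Q))"
    using card_blocks_at[OF assms(1)] by simp
  finally show ?thesis by simp
qed

text \<open>Seen from the root all weights coincide, so \<open>sum_sphere_flow\<close> counts the
  sphere.\<close>

lemma card_sphere:
  assumes "M > 0"
  shows "real (card (sphere M)) = real r * real (k - 1) / Q * Q ^ M"
proof -
  have b0: "d b b = 0" using d_eq_0_iff root_in by simp
  have "real (card (sphere M)) * (1 / Q) ^ M = (\<Sum>z\<in>sphere M. (1 / Q) ^ d b z)"
    using d_commute root_in by (simp add: sphere_def)
  also have "\<dots> = real r * real (k - 1) / Q" using sum_sphere_flow[of b M] root_in assms b0 by simp
  finally show ?thesis using Q_ge_1 by (simp add: field_simps)
qed

text \<open>Induction on \<open>d y x\<close>. The triangle inequality is proved along with the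
  formula because it keeps the vertices used inside the sphere, where branches have mass 1. The sum
  for a new vertex \<open>y'\<close> is compared with \<open>u\<close> times the sum for the next
  vertex \<open>y\<close> towards \<open>x\<close>.\<close>

lemma sum_sphere_kernel:
  assumes uv: "u * v = of_real (1 / Q)" and x: "x \<in> V" and y: "y \<in> V"
  shows "d y b \<le> d x b + d y x"
    and "M > d x b + d y x \<Longrightarrow> (\<Sum>z\<in>sphere M. u ^ d y z * v ^ d x z) =
      of_real (real r * real (k - 1) / Q) * spherical (of_real (Q / (real r * real (k - 1)))) (of_nat (k - 1)) u v (d y x)"
  using y
proof (induction "d y x" arbitrary: y)
  case 0
  {
    case 1
    then show ?case using 0 d_eq_0_iff x by auto
  next
    case 2
    have "y = x" using 0 2 d_eq_0_iff x by auto
    have "(\<Sum>z\<in>sphere M. u ^ d y z * v ^ d x z) = of_real (\<Sum>z\<in>sphere M. (1 / Q) ^ d y z)"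
      unfolding of_real_sum of_real_power uv[symmetric] \<open>y = x\<close> by (simp add: power_mult_distrib)
    then show ?case using sum_sphere_flow[of y M] 2 0 \<open>y = x\<close> by (simp del: of_real_sum of_real_power)
  }
next
  case (Suc n y')
  have aux: "d y' b \<le> d x b + d y' x \<and> (M > d x b + d y' x \<longrightarrow>
      (\<Sum>z\<in>sphere M. u ^ d y' z * v ^ d x z) =
        of_real (real r * real (k - 1) / Q) * spherical (of_real (Q / (real r * real (k - 1)))) (of_nat (k - 1)) u v (d y' x))"
    if y': "y' \<in> V"
  proof -
    have "y' \<noteq> x" using Suc(3) d_eq_0_iff x y' by (metis nat.distinct(1))
    then obtain S where S: "S \<in> B" "y' \<in> S" "gate S x \<noteq> y'" using gate_neq_exists x y' by blast
    define y where "y = gate S x"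
    have y: "y \<in> S" "y \<in> V" "y \<noteq> y'" using S gate_in x block_subset unfolding y_def by blast+
    have dS: "d w x = Suc n" if "w \<in> S - {y}" for w
      using d_gate[of S x w] d_gate[of S x y'] that S x Suc(3) y_def by auto
    have dy: "d y x = n" using d_gate[of S x y'] S x y Suc(3) y_def by simp
    have yb: "d y b \<le> d x b + n" using Suc(1)[of y] y dy by simp
    have bS: "d w b \<le> Suc (d x b + n)" if "w \<in> S" for w
      using d_block_le[of S w y b] that S y root_in yb by simp
    have "(\<Sum>z\<in>sphere M. u ^ d y' z * v ^ d x z) =
        of_real (real r * real (k - 1) / Q) * spherical (of_real (Q / (real r * real (k - 1)))) (of_nat (k - 1)) u v (d y' x)" if M: "M > d x b + d y' x"
    proof -
      have flow: "branch_flow M S w = 1" if "w \<in> S" for w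
        using branch_flow_eq_1[of S w M] S bS[OF that] that M Suc(3) by simp
      \<comment> \<open>The sphere is sorted by the gate \<open>w\<close> of \<open>z\<close> in
        \<open>S\<close>. With e = \<open>d w z\<close>, the difference of powers is 0 for
        \<open>w = y\<close>, (1 - u^2) u^e for \<open>w = y'\<close>, and (u - u^2) u^e for the
        other k - 2 vertices. For \<open>w \<noteq> y\<close>, \<open>d x z\<close> is n + 1 + e, so
        a factor (u v)^e = Q^(-e) splits off and sums to the branch mass 1.\<close>
      have "(\<Sum>z\<in>sphere M. (u ^ d y' z - u ^ Suc (d y z)) * v ^ d x z) =
        (\<Sum>w\<in>S. \<Sum>z | z \<in> sphere M \<and> gate S z = w. (u ^ d y' z - u ^ Suc (d y z)) * v ^ d x z)"
        by (rule sum.group[symmetric])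
          (use finite_sphere finite_block S gate_in in \<open>auto simp: sphere_def\<close>)
      also have "\<dots> = (\<Sum>w\<in>S. if w = y then 0 else if w = y' then (1 - u\<^sup>2) * v ^ Suc n
          else (u - u\<^sup>2) * v ^ Suc n)"
      proof (rule sum.cong[OF refl])
        fix w assume w: "w \<in> S"
        let ?c = "if w = y then 0 else if w = y' then (1 - u\<^sup>2) * v ^ Suc n
          else (u - u\<^sup>2) * v ^ Suc n"
        have "(\<Sum>z | z \<in> sphere M \<and> gate S z = w. (u ^ d y' z - u ^ Suc (d y z)) * v ^ d x z) =
          (\<Sum>z | z \<in> sphere M \<and> gate S z = w. ?c * of_real ((1 / Q) ^ d w z))"
        proof (rule sum.cong[OF refl])
          fix z assume "z \<in> {z. z \<in> sphere M \<and> gate S z = w}"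
          then have z: "z \<in> V" "gate S z = w" by (auto simp: sphere_def)
          have uvw: "of_real ((1 / Q) ^ d w z) = u ^ d w z * v ^ d w z"
            by (metis of_real_power uv power_mult_distrib)
          have dz: "d w' z = Suc (d w z)" if "w' \<in> S" "w' \<noteq> w" for w'
            using d_gate[of S z w'] that z S by simp
          have xz: "d x z = Suc n + d w z" if "w \<noteq> y"
            using d_through_gate[of S x z w] dS[of w] w that S x z y_def d_commute[of w x]
              block_subset[of S] by auto
          consider "w = y" | "w \<noteq> y" "w = y'" | "w \<noteq> y" "w \<noteq> y'" by blast
          then show "(u ^ d y' z - u ^ Suc (d y z)) * v ^ d x z = ?c * of_real ((1 / Q) ^ d w z)"
          proof cases
            case 1
            then show ?thesis using dz[of y'] S y by simp
          next
            case 2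
            then show ?thesis using dz[of y] xz y unfolding uvw
              by (simp add: power_add algebra_simps power2_eq_square)
          next
            case 3
            then show ?thesis using dz[of y] dz[of y'] xz y S unfolding uvw
              by (simp add: power_add algebra_simps power2_eq_square)
          qed
        qed
        also have "\<dots> = ?c * of_real (branch_flow M S w)"
          unfolding branch_flow_def by (simp add: sum_distrib_left)
        finally show "(\<Sum>z | z \<in> sphere M \<and> gate S z = w.
            (u ^ d y' z - u ^ Suc (d y z)) * v ^ d x z) = ?c" using flow[OF w] by simp
      qed
      also have "\<dots> = (\<Sum>w\<in>S - {y} - {y'}. (u - u\<^sup>2) * v ^ Suc n) + (1 - u\<^sup>2) * v ^ Suc n"
        using finite_block[OF S(1)] y S by (simp add: sum.remove[of S y] sum.remove[of "S - {y}" y'])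
      also have "\<dots> = of_nat (k - 2) * ((u - u\<^sup>2) * v ^ Suc n) + (1 - u\<^sup>2) * v ^ Suc n"
        using finite_block[OF S(1)] y S card_block[OF S(1)] by (simp add: numeral_2_eq_2)
      also have "\<dots> = (1 - u) * (1 + of_nat (k - 1) * u) * v ^ Suc n"
      proof -
        have "(of_nat (k - 1) :: complex) = of_nat (k - 2) + 1"
          using k_ge_2 by (metis Suc_1 Suc_diff_Suc Suc_le_lessD add.commute of_nat_Suc)
        then show ?thesis by (simp add: algebra_simps power2_eq_square)
      qed
      finally have diff: "(\<Sum>z\<in>sphere M. (u ^ d y' z - u ^ Suc (d y z)) * v ^ d x z) =
        (1 - u) * (1 + of_nat (k - 1) * u) * v ^ Suc n" .
      have IH: "(\<Sum>z\<in>sphere M. u ^ d y z * v ^ d x z) =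
          of_real (real r * real (k - 1) / Q) * spherical (of_real (Q / (real r * real (k - 1)))) (of_nat (k - 1)) u v n"
        using Suc(2)[of y] y dy M Suc(3) by simp
      have "(\<Sum>z\<in>sphere M. u ^ d y' z * v ^ d x z) =
          (\<Sum>z\<in>sphere M. (u ^ d y' z - u ^ Suc (d y z)) * v ^ d x z) +
          u * (\<Sum>z\<in>sphere M. u ^ d y z * v ^ d x z)"
        by (simp add: sum_distrib_left sum.distrib[symmetric] algebra_simps)
      also have "\<dots> = of_real (real r * real (k - 1) / Q) * spherical (of_real (Q / (real r * real (k - 1)))) (of_nat (k - 1)) u v (Suc n)"
      proof -
        define \<kappa> :: complex where "\<kappa> = of_real (Q / (real r * real (k - 1)))"
        have *: "of_real (real r * real (k - 1) / Q) * \<kappa> = 1"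
          unfolding \<kappa>_def of_real_mult[symmetric] using Q_ge_1 k_ge_2 r_ge_2 by simp
        have "C * (u * s + \<kappa> * p * q * w) = p * q * w + u * (C * s)" if "C * \<kappa> = 1"
          for C s p q w :: complex
        proof -
          have "C * (u * s + \<kappa> * p * q * w) = (C * \<kappa>) * (p * q * w) + u * (C * s)"
            by (simp add: algebra_simps)
          then show ?thesis using that by simp
        qed
        from this[OF *] show ?thesis unfolding diff IH spherical.simps \<kappa>_def[symmetric] by simp
      qed
      finally show ?thesis using Suc(3) by simp
    qed
    then show ?thesis using bS[OF S(2)] Suc(3) by simp
  qed
  {
    case 1 then show ?case using aux by blast
  next
    case 2 then show ?case using aux by blast
  }
qed

end

section \<open>The polygons of a symmetric graph\<close>

context symmetric_graph
begin

abbreviation "Pg \<equiv> polygons k V E"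

text \<open>Adjacency through sides of polygons in \<open>\<S>\<close>. Its reflexive transitive
  closure replaces walks: the order and repetition of the polygons do not matter, and avoiding a
  polygon is a set difference.\<close>

definition steps :: "'v set set set \<Rightarrow> ('v \<times> 'v) set" where
  "steps \<S> = {(x, y). \<exists>S\<in>\<S>. {x, y} \<in> S}"

lemma polygonE:
  assumes "S \<in> Pg"
  obtains p where "is_polygon k V E p" "S = polygon_edges p"
  using assms unfolding polygons_def by blast

lemma polygon_edges_alt:
  "polygon_edges p = {{p ! i, p ! (Suc i mod length p)} | i. i < length p}"
  unfolding polygon_edges_def closed_steps_def by auto

lemma polygon_subset: "S \<in> Pg \<Longrightarrow> S \<subseteq> E"
  by (erule polygonE) (auto simp: polygon_edges_alt is_polygon_def is_closed_walk_def)

lemma edge_in_V: "{x, y} \<in> E \<Longrightarrow> x \<in> V \<and> y \<in> V \<and> x \<noteq> y"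
  using edges[of "{x, y}"] by (auto simp: doubleton_eq_iff)

lemma Union_polygon_edges: "\<Union>(polygon_edges p) = set p"
proof
  have "Suc i mod length p < length p" if "i < length p" for i
    using that by (intro mod_less_divisor) linarith
  then show "\<Union>(polygon_edges p) \<subseteq> set p" unfolding polygon_edges_alt by auto
  show "set p \<subseteq> \<Union>(polygon_edges p)"
  proof
    fix x assume "x \<in> set p"
    then obtain i where "i < length p" "x = p ! i" unfolding in_set_conv_nth by blast
    then show "x \<in> \<Union>(polygon_edges p)" unfolding polygon_edges_alt by blast
  qed
qed

lemma Union_polygon_subset: "S \<in> Pg \<Longrightarrow> \<Union>S \<subseteq> V"
  by (erule polygonE) (auto simp: Union_polygon_edges is_polygon_def is_closed_walk_def)

lemma card_Union_polygon: "S \<in> Pg \<Longrightarrow> card (\<Union>S) = k"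
  by (erule polygonE) (auto simp: Union_polygon_edges is_polygon_def distinct_card)

lemma polygon_nonempty: "S \<in> Pg \<Longrightarrow> \<Union>S \<noteq> {}"
  by (erule polygonE) (auto simp: Union_polygon_edges is_polygon_def is_closed_walk_def)

lemma edge_polygon_unique: "S \<in> Pg \<Longrightarrow> T \<in> Pg \<Longrightarrow> {x, y} \<in> S \<Longrightarrow> {x, y} \<in> T \<Longrightarrow> S = T"
proof (rule ccontr)
  assume *: "S \<in> Pg" "T \<in> Pg" "{x, y} \<in> S" "{x, y} \<in> T" "S \<noteq> T"
  then have "x \<in> V" using polygon_subset edge_in_V by blast
  moreover have "x \<in> \<Union>S" "x \<in> \<Union>T" using * by blast+
  ultimately have "S \<inter> T = {}" using polygons_meet * by blast
  then show False using * by blast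
qed

lemma common_vertices:
  assumes "S \<in> Pg" "T \<in> Pg" "x \<in> \<Union>S" "x \<in> \<Union>T" "y \<in> \<Union>S" "y \<in> \<Union>T" "x \<noteq> y"
  shows "S = T"
proof (rule ccontr)
  assume "S \<noteq> T"
  moreover have "x \<in> V" using assms Union_polygon_subset by blast
  ultimately have "\<Union>S \<inter> \<Union>T = {x}" using polygons_meet assms(1-4) by blast
  moreover have "y \<in> \<Union>S \<inter> \<Union>T" using assms(5,6) by (rule IntI)
  ultimately show False using assms(7) by simp
qed

lemma sym_steps: "sym (steps \<S>)"
  unfolding sym_def steps_def by (auto simp: insert_commute)

lemma rtrancl_steps_sym: "(x, y) \<in> (steps \<S>)\<^sup>* \<Longrightarrow> (y, x) \<in> (steps \<S>)\<^sup>*"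
  using sym_rtrancl[OF sym_steps] by (rule symD)

lemma steps_mono: "\<S> \<subseteq> \<T> \<Longrightarrow> (steps \<S>)\<^sup>* \<subseteq> (steps \<T>)\<^sup>*"
  by (intro rtrancl_mono) (auto simp: steps_def)

lemma steps_in_V: "(x, y) \<in> steps \<S> \<Longrightarrow> \<S> \<subseteq> Pg \<Longrightarrow> {x, y} \<in> E \<and> x \<in> V \<and> y \<in> V"
proof -
  assume "(x, y) \<in> steps \<S>" "\<S> \<subseteq> Pg"
  then have "{x, y} \<in> E" unfolding steps_def using polygon_subset by blast
  then show ?thesis using edge_in_V by blast
qed

section \<open>The distance as the least number of connecting polygons\<close>

lemma finite_crossed_polygons: "finite (crossed_polygons k V E p)"
proof -
  have "finite {S \<in> Pg. {x, y} \<in> S}" for x y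
  proof (cases "\<exists>S\<in>Pg. {x, y} \<in> S")
    case True
    then obtain S where "S \<in> Pg" "{x, y} \<in> S" by blast
    then have "{T \<in> Pg. {x, y} \<in> T} \<subseteq> {S}" using edge_polygon_unique by blast
    then show ?thesis by (rule finite_subset) simp
  next
    case False
    then have "{T \<in> Pg. {x, y} \<in> T} = {}" by blast
    then show ?thesis by (simp only: finite.emptyI)
  qed
  then have "finite (\<Union>i<length p. {S \<in> Pg. {p ! i, p ! Suc i} \<in> S})" by blast
  moreover have "crossed_polygons k V E p \<subseteq> (\<Union>i<length p. {S \<in> Pg. {p ! i, p ! Suc i} \<in> S})"
  proof
    fix S assume "S \<in> crossed_polygons k V E p"
    then obtain i where "S \<in> Pg" "Suc i < length p" "{p ! i, p ! Suc i} \<in> S"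
      unfolding crossed_polygons_def by blast
    then show "S \<in> (\<Union>i<length p. {S \<in> Pg. {p ! i, p ! Suc i} \<in> S})"
      by (intro UN_I[of i]) auto
  qed
  ultimately show ?thesis by (rule finite_subset[rotated])
qed

lemma walk_imp_steps:
  assumes "is_walk V E p"
  shows "(hd p, last p) \<in> (steps (crossed_polygons k V E p))\<^sup>*"
proof -
  have "(p ! 0, p ! i) \<in> (steps (crossed_polygons k V E p))\<^sup>*" if "i < length p" for i
    using that
  proof (induction i)
    case (Suc i)
    have "{p ! i, p ! Suc i} \<in> E" using assms Suc.prems unfolding is_walk_def by blast
    then obtain S where "S \<in> Pg" "{p ! i, p ! Suc i} \<in> S" using edge_in_polygon by blast
    then have "(p ! i, p ! Suc i) \<in> steps (crossed_polygons k V E p)"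
      using Suc.prems unfolding steps_def crossed_polygons_def by blast
    then show ?case using Suc by (meson Suc_lessD rtrancl.rtrancl_into_rtrancl)
  qed simp
  from this[of "length p - 1"] show ?thesis
    using assms by (simp add: is_walk_def hd_conv_nth last_conv_nth)
qed

lemma steps_imp_walk:
  assumes "(x, y) \<in> (steps \<S>)\<^sup>*" "\<S> \<subseteq> Pg" "x \<in> V"
  shows "\<exists>p. is_walk V E p \<and> hd p = x \<and> last p = y \<and> crossed_polygons k V E p \<subseteq> \<S>"
  using assms(1)
proof (induction rule: rtrancl_induct)
  case base
  have "is_walk V E [x] \<and> hd [x] = x \<and> last [x] = x \<and> crossed_polygons k V E [x] \<subseteq> \<S>"
    using assms by (simp add: is_walk_def crossed_polygons_def)
  then show ?case by blast
next
  case (step y z)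
  then obtain p where p: "is_walk V E p" "hd p = x" "last p = y" "crossed_polygons k V E p \<subseteq> \<S>"
    by blast
  obtain S where S: "S \<in> \<S>" "{y, z} \<in> S" using step unfolding steps_def by blast
  have ne: "p \<noteq> []" using p by (simp add: is_walk_def)
  have yz: "{y, z} \<in> E" "z \<in> V" using steps_in_V[OF step(2) assms(2)] by auto
  \<comment> \<open>Neighbours in the extended list are either neighbours in \<open>p\<close> or the
    new side from \<open>y\<close> to \<open>z\<close>.\<close>
  have nth: "(p @ [z]) ! i = p ! i \<and> (p @ [z]) ! Suc i = p ! Suc i \<and> Suc i < length p \<or>
      (p @ [z]) ! i = y \<and> (p @ [z]) ! Suc i = z" if "Suc i < length (p @ [z])" for i
    using that p(3) ne by (cases "Suc i < length p")
      (auto simp: nth_append last_conv_nth less_Suc_eq intro: arg_cong[where f = "(!) p"])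
  have "is_walk V E (p @ [z])"
    using p(1) yz nth unfolding is_walk_def by auto metis
  moreover have "crossed_polygons k V E (p @ [z]) \<subseteq> \<S>"
  proof
    fix T assume "T \<in> crossed_polygons k V E (p @ [z])"
    then obtain i where T: "T \<in> Pg" "Suc i < length (p @ [z])" "{(p @ [z]) ! i, (p @ [z]) ! Suc i} \<in> T"
      unfolding crossed_polygons_def by blast
    from nth[OF T(2)] show "T \<in> \<S>"
    proof
      assume "(p @ [z]) ! i = p ! i \<and> (p @ [z]) ! Suc i = p ! Suc i \<and> Suc i < length p"
      then have "T \<in> crossed_polygons k V E p" using T unfolding crossed_polygons_def by auto
      then show ?thesis using p by blast
    next
      assume "(p @ [z]) ! i = y \<and> (p @ [z]) ! Suc i = z"
      then have "T = S" using edge_polygon_unique[of T S y z] T S assms by auto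
      then show ?thesis using S by simp
    qed
  qed
  ultimately have "is_walk V E (p @ [z]) \<and> hd (p @ [z]) = x \<and> last (p @ [z]) = z \<and>
      crossed_polygons k V E (p @ [z]) \<subseteq> \<S>" using p ne by simp
  then show ?case by blast
qed

lemma gdist_le:
  assumes "(x, y) \<in> (steps \<S>)\<^sup>*" "\<S> \<subseteq> Pg" "finite \<S>" "x \<in> V"
  shows "gdist k V E x y \<le> card \<S>"
proof -
  obtain p where p: "is_walk V E p" "hd p = x" "last p = y" "crossed_polygons k V E p \<subseteq> \<S>"
    using steps_imp_walk assms by blast
  have "gdist k V E x y \<le> card (crossed_polygons k V E p)"
    unfolding gdist_def by (rule Least_le) (use p in blast)
  also have "\<dots> \<le> card \<S>" using p assms by (intro card_mono)
  finally show ?thesis .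
qed

text \<open>Take the polygons crossed by an optimal walk. With \<open>gdist_le\<close>, the distance
  is the least size of a finite set of polygons connecting the two vertices.\<close>

lemma gdist_attained:
  assumes "x \<in> V" "y \<in> V"
  obtains \<S> where "\<S> \<subseteq> Pg" "finite \<S>" "card \<S> = gdist k V E x y" "(x, y) \<in> (steps \<S>)\<^sup>*"
proof -
  have "\<exists>n p. is_walk V E p \<and> hd p = x \<and> last p = y \<and> card (crossed_polygons k V E p) = n"
    using connected[OF assms] by blast
  then have "\<exists>p. is_walk V E p \<and> hd p = x \<and> last p = y \<and>
      card (crossed_polygons k V E p) = gdist k V E x y"
    unfolding gdist_def by (rule LeastI_ex)
  then obtain p where "is_walk V E p" "hd p = x" "last p = y"
    "card (crossed_polygons k V E p) = gdist k V E x y" by blast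
  then show thesis
    using that[of "crossed_polygons k V E p"] walk_imp_steps[of p] finite_crossed_polygons
    by (auto simp: crossed_polygons_def)
qed

lemma gdist_commute:
  assumes "x \<in> V" "y \<in> V"
  shows "gdist k V E x y = gdist k V E y x"
proof -
  have "gdist k V E x y \<le> gdist k V E y x" if xy: "x \<in> V" "y \<in> V" for x y
    by (rule gdist_attained[OF xy(2,1)]) (metis gdist_le rtrancl_steps_sym xy(1))
  then show ?thesis using assms by (simp add: order_antisym)
qed

lemma gdist_eq_0_iff:
  assumes "x \<in> V" "y \<in> V"
  shows "gdist k V E x y = 0 \<longleftrightarrow> x = y"
proof
  assume "gdist k V E x y = 0"
  moreover obtain \<S> where S: "\<S> \<subseteq> Pg" "finite \<S>" "card \<S> = gdist k V E x y" "(x, y) \<in> (steps \<S>)\<^sup>*"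
    by (rule gdist_attained[OF assms])
  ultimately have "steps \<S> = {}" by (simp add: steps_def)
  then show "x = y" using S by simp
next
  assume "x = y"
  then show "gdist k V E x y = 0" using gdist_le[of x y "{}"] assms by simp
qed

text \<open>The vertex \<open>g\<close> is the endpoint of the last side of \<open>S\<close> on the path.\<close>
lemma steps_last_use:
  assumes "(x, z) \<in> (steps \<S>)\<^sup>*"
  shows "(x, z) \<in> (steps (\<S> - {S}))\<^sup>* \<or> (\<exists>g\<in>\<Union>S. (g, z) \<in> (steps (\<S> - {S}))\<^sup>*)"
  using assms
proof (induction rule: rtrancl_induct)
  case (step y z)
  show ?case
  proof (cases "(y, z) \<in> steps (\<S> - {S})")
    case True
    then show ?thesis using step.IH by (meson rtrancl.rtrancl_into_rtrancl)
  next
    case False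
    then have "{y, z} \<in> S" using step unfolding steps_def by blast
    then show ?thesis by blast
  qed
qed simp

lemma steps_within_polygon:
  assumes "S \<in> Pg" "x \<in> \<Union>S" "y \<in> \<Union>S"
  shows "(x, y) \<in> (steps {S})\<^sup>*"
proof -
  obtain p where p: "is_polygon k V E p" "S = polygon_edges p" using polygonE[OF assms(1)] .
  have "(p ! 0, p ! i) \<in> (steps {S})\<^sup>*" if "i < length p" for i
    using that
  proof (induction i)
    case (Suc i)
    have "(p ! i, p ! Suc i) \<in> steps {S}"
      using Suc.prems unfolding steps_def p(2) polygon_edges_alt by force
    then show ?case using Suc by (meson Suc_lessD rtrancl.rtrancl_into_rtrancl)
  qed simp
  then have "(p ! 0, z) \<in> (steps {S})\<^sup>*" if "z \<in> set p" for z
    using that by (auto simp: in_set_conv_nth)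
  then show ?thesis using assms unfolding p(2) Union_polygon_edges
    by (meson rtrancl_steps_sym rtrancl_trans)
qed

section \<open>Simple closed walks and separation by polygons\<close>

lemma polygon_rotate:
  assumes "is_polygon k V E p"
  shows "is_polygon k V E (rotate n p)" "polygon_edges (rotate n p) = polygon_edges p"
proof -
  have closed: "is_closed_walk V E (rotate1 q)" if "is_closed_walk V E q" for q
  proof -
    have "{rotate1 q ! i, rotate1 q ! (Suc i mod length q)} \<in> E" if "i < length q" for i
    proof -
      have ne: "0 < length q" using that by linarith
      have "rotate1 q ! i = q ! (Suc i mod length q)" using that by (simp add: nth_rotate1)
      moreover have "rotate1 q ! (Suc i mod length q) = q ! (Suc (Suc i mod length q) mod length q)"
        using ne by (simp add: nth_rotate1)
      moreover have "Suc i mod length q < length q" using ne by simp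
      ultimately show ?thesis using \<open>is_closed_walk V E q\<close> unfolding is_closed_walk_def by metis
    qed
    then show ?thesis using that unfolding is_closed_walk_def by simp
  qed
  have edges: "polygon_edges (rotate1 q) \<subseteq> polygon_edges q" for q :: "'v list"
  proof
    fix e assume "e \<in> polygon_edges (rotate1 q)"
    then obtain i where i: "i < length q" "e = {rotate1 q ! i, rotate1 q ! (Suc i mod length q)}"
      unfolding polygon_edges_alt by auto
    have ne: "0 < length q" using i by linarith
    have "e = {q ! (Suc i mod length q), q ! (Suc (Suc i mod length q) mod length q)}"
      using i ne by (simp add: nth_rotate1)
    then show "e \<in> polygon_edges q" using ne unfolding polygon_edges_alt by force
  qed
  show "is_polygon k V E (rotate n p)"
    by (induction n) (use assms closed in \<open>auto simp: is_polygon_def\<close>)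
  have sub: "polygon_edges (rotate n q) \<subseteq> polygon_edges q" for n and q :: "'v list"
  proof (induction n)
    case (Suc n)
    then show ?case using edges[of "rotate n q"] by simp
  qed simp
  \<comment> \<open>Rotating on by the complementary amount returns to \<open>p\<close>, so the
    inclusion \<open>sub\<close> holds in both directions.\<close>
  have "p = rotate (length p - n mod length p) (rotate n p)"
  proof (cases "p = []")
    case False
    then have "rotate (length p - n mod length p) (rotate n p) =
        rotate (length p - n mod length p + n) p" by (simp add: rotate_rotate)
    also have "\<dots> = rotate ((length p - n mod length p + n) mod length p) p"
      by (rule rotate_conv_mod)
    also have "(length p - n mod length p + n) mod length p = 0"
    proof -
      have "(length p - n mod length p + n) mod length p =
          (length p - n mod length p + n mod length p) mod length p" by (simp add: mod_add_right_eq)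
      also have "length p - n mod length p + n mod length p = length p"
        using False by (simp add: less_imp_le)
      finally show ?thesis by simp
    qed
    finally show ?thesis by simp
  qed simp
  then show "polygon_edges (rotate n p) = polygon_edges p"
    using sub[of n p] sub[of "length p - n mod length p" "rotate n p"] by auto
qed

text \<open>The steps of a polygon running inside a simple closed walk use up the whole walk.\<close>
lemma distinct_loop_polygon:
  assumes "is_closed_walk V E c" "distinct c" "length c \<ge> 3"
  shows "polygon_edges c \<in> Pg"
proof -
  \<comment> \<open>With at least three vertices, moving on by two never returns to the same index,
    so a simple closed walk does not turn back.\<close>
  have neq: "i \<noteq> (i + 2) mod length c" if "i < length c" for i
  proof (cases "i + 2 < length c")
    case False
    then have "(i + 2) mod length c = i + 2 - length c"
      using that assms(3) by (simp add: le_mod_geq)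
    then show ?thesis using that assms(3) False by linarith
  qed simp
  have "nontrivial_loop V E c"
    unfolding nontrivial_loop_def
  proof (intro conjI allI impI)
    fix i assume i: "i < length c"
    have "(i + 2) mod length c < length c" using i by (intro mod_less_divisor) linarith
    then show "c ! i \<noteq> c ! ((i + 2) mod length c)"
      using neq[OF i] assms(2) i by (simp add: nth_eq_iff_index_eq)
  qed (fact assms(1))
  then obtain p where p: "is_polygon k V E p" "closed_steps p \<subseteq> closed_steps c"
    using loops by blast
  have ne: "0 < length p" using p unfolding is_polygon_def is_closed_walk_def by blast
  \<comment> \<open>In the simple walk \<open>c\<close> each vertex has a single outgoing step. The
    step of \<open>p\<close> from this vertex is also a step of \<open>c\<close>, hence the same
    one.\<close>
  have step: "(c ! i, c ! (Suc i mod length c)) \<in> closed_steps p" if i: "i < length c" "c ! i \<in> set p" for i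
  proof -
    obtain j where j: "j < length p" "p ! j = c ! i" using i unfolding in_set_conv_nth by blast
    then have in_p: "(c ! i, p ! (Suc j mod length p)) \<in> closed_steps p"
      unfolding closed_steps_def by force
    then obtain i' where "i' < length c" "c ! i' = c ! i" "p ! (Suc j mod length p) = c ! (Suc i' mod length c)"
      using p(2) unfolding closed_steps_def[of c] by force
    then show ?thesis using in_p i assms(2) by (metis nth_eq_iff_index_eq)
  qed
  \<comment> \<open>Following \<open>c\<close> from a common vertex therefore never leaves
    \<open>p\<close>.\<close>
  have all: "c ! ((i0 + n) mod length c) \<in> set p" if "i0 < length c" "c ! i0 \<in> set p" for i0 n
  proof (induction n)
    case (Suc n)
    have "(i0 + n) mod length c < length c" using that by (intro mod_less_divisor) linarith
    from step[OF this Suc] have "c ! (Suc (i0 + n) mod length c) \<in> set p"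
      unfolding closed_steps_def using ne by (auto simp: mod_Suc_eq intro!: nth_mem)
    then show ?case by simp
  qed (use that in simp)
  have "(p ! 0, p ! (Suc 0 mod length p)) \<in> closed_steps c"
    using p(2) ne unfolding closed_steps_def[of p] by blast
  then obtain i0 where i0: "i0 < length c" "c ! i0 = p ! 0" unfolding closed_steps_def by auto
  have "c ! i \<in> set p" if "i < length c" for i
  proof -
    have "(i0 + (length c - i0 + i)) mod length c = i" using i0 that by simp
    then show ?thesis using all[of i0 "length c - i0 + i"] i0 ne by (metis nth_mem)
  qed
  then have "closed_steps c \<subseteq> closed_steps p" using step unfolding closed_steps_def[of c] by blast
  then have "closed_steps c = closed_steps p" using p by blast
  then show ?thesis using p unfolding polygons_def polygon_edges_def by auto
qed

text \<open>Otherwise a shortest connection outside \<open>S\<close> between distinct vertices of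
  \<open>S\<close>, closed up along an arc of \<open>S\<close>, is a simple closed walk. By
  \<open>distinct_loop_polygon\<close> it bounds a polygon, which differs from \<open>S\<close> but
  shares two vertices with it.\<close>

lemma polygon_separates:
  assumes S: "S \<in> Pg" and "s \<in> \<Union>S" "t \<in> \<Union>S" "(s, t) \<in> (steps (Pg - {S}))\<^sup>*"
  shows "s = t"
proof (rule ccontr)
  assume "s \<noteq> t"
  define R where "R = steps (Pg - {S})"
  \<comment> \<open>The length is minimised over all pairs of distinct vertices of \<open>S\<close>
    at once. This excludes repetitions on the path and also interior vertices in
    \<open>S\<close>.\<close>
  define P where "P n \<longleftrightarrow> (\<exists>s\<in>\<Union>S. \<exists>t\<in>\<Union>S. s \<noteq> t \<and> (s, t) \<in> R ^^ n)" for n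
  have "\<exists>n. P n" unfolding P_def R_def using assms \<open>s \<noteq> t\<close> rtrancl_imp_relpow by meson
  then obtain n where n: "P n" "\<And>m. m < n \<Longrightarrow> \<not> P m" using exists_least_iff[of P] by blast
  then obtain s t where st: "s \<in> \<Union>S" "t \<in> \<Union>S" "s \<noteq> t" "(s, t) \<in> R ^^ n" unfolding P_def by blast
  obtain f where f: "f 0 = s" "f n = t" "\<And>i. i < n \<Longrightarrow> (f i, f (Suc i)) \<in> R"
    using st(4) unfolding relpow_fun_conv by blast
  have seg: "(f i, f j) \<in> R ^^ (j - i)" if "i \<le> j" "j \<le> n" for i j
    unfolding relpow_fun_conv
    by (rule exI[of _ "\<lambda>m. f (i + m)"]) (use that f(3) in auto)
  have inj: "f i \<noteq> f j" if "i < j" "j \<le> n" for i j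
  proof
    assume "f i = f j"
    then have "(s, t) \<in> R ^^ (i + (n - j))"
      using seg[of 0 i] seg[of j n] that f(1,2) unfolding relpow_add by auto
    then have "P (i + (n - j))" unfolding P_def using st by blast
    moreover have "i + (n - j) < n" using that by linarith
    ultimately show False using n(2) by blast
  qed
  have interior: "f i \<notin> \<Union>S" if "0 < i" "i < n" for i
  proof
    assume fS: "f i \<in> \<Union>S"
    have "s \<noteq> f i" using inj[of 0 i] that f(1,2) by auto
    moreover have "(s, f i) \<in> R ^^ i" using seg[of 0 i] that f(1,2) by simp
    ultimately have "P i" unfolding P_def by (intro bexI[OF _ st(1)] bexI[OF _ fS] conjI)
    then show False using n(2)[OF that(2)] by contradiction
  qed
  have npos: "n > 0" using st f by (cases n) auto
  obtain p0 where p0: "is_polygon k V E p0" "S = polygon_edges p0" using polygonE[OF S] .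
  obtain m where m: "m < length p0" "p0 ! m = s"
    using st(1) unfolding p0(2) Union_polygon_edges by (auto simp: in_set_conv_nth)
  define p where "p = rotate m p0"
  have p: "is_polygon k V E p" "S = polygon_edges p" using polygon_rotate[OF p0(1)] p0 p_def by auto
  have p0s: "p ! 0 = s" using m nth_rotate[of 0 p0 m] unfolding p_def by (cases "p0 = []") auto
  obtain j where j: "j < length p" "p ! j = t"
    using st(2) unfolding p(2) Union_polygon_edges by (auto simp: in_set_conv_nth)
  have j0: "0 < j" using j p0s st by (cases j) auto
  have dp: "distinct p" using p by (simp add: is_polygon_def)
  have SE: "{p ! i, p ! (Suc i mod length p)} \<in> S" if "i < length p" for i
    using that unfolding p(2) polygon_edges_alt by blast
  \<comment> \<open>The path from \<open>s\<close> up to, but excluding, \<open>t\<close>, then the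
    polygon from \<open>t = p ! j\<close> to its last vertex, from which a side of \<open>S\<close>
    leads back to \<open>s = p ! 0\<close>.\<close>
  define c where "c = map f [0..<n] @ drop j p"
  have len: "length c = n + (length p - j)" unfolding c_def by simp
  have c1: "c ! i = f i" if "i \<le> n" for i
    using that j f by (cases "i = n") (auto simp: c_def nth_append)
  have c2: "c ! (n + i) = p ! (j + i)" if "j + i < length p" for i
    using that by (simp add: c_def nth_append)
  have stepE: "(c ! i, c ! Suc i) \<in> R \<or> {c ! i, c ! Suc i} \<in> S" if "Suc i < length c" for i
  proof (cases "i < n")
    case True
    then show ?thesis using f(3)[of i] c1 by simp
  next
    case False
    then have "c ! i = p ! (j + (i - n))" "c ! Suc i = p ! Suc (j + (i - n))"
      using c2[of "i - n"] c2[of "Suc i - n"] that len by (auto simp: Suc_diff_le)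
    then show ?thesis using SE[of "j + (i - n)"] that len False by auto
  qed
  have RE: "{x, y} \<in> E" if "(x, y) \<in> R" for x y
    using steps_in_V[of x y "Pg - {S}"] that unfolding R_def by blast
  have lastE: "{c ! (length c - 1), c ! 0} \<in> S"
  proof -
    have "c ! (length c - 1) = p ! (length p - 1)"
      using c2[of "length p - 1 - j"] len j by auto
    then show ?thesis using SE[of "length p - 1"] j c1[of 0] f p0s by (cases "length p") auto
  qed
  have closedE: "{c ! i, c ! (Suc i mod length c)} \<in> E" if "i < length c" for i
  proof (cases "Suc i < length c")
    case True
    then show ?thesis using stepE[OF True] RE polygon_subset[OF S] by auto
  next
    case False
    then have "Suc i = length c" using that by simp
    then have "i = length c - 1" "Suc i mod length c = 0" by auto
    then show ?thesis using lastE polygon_subset[OF S] by auto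
  qed
  have "set c \<subseteq> V"
  proof
    fix x assume "x \<in> set c"
    then obtain i where "i < length c" "x = c ! i" by (auto simp: in_set_conv_nth)
    then show "x \<in> V" using closedE edge_in_V by blast
  qed
  then have cw: "is_closed_walk V E c" unfolding is_closed_walk_def
    using closedE len npos by auto
  have setp: "x \<in> \<Union>S" if "x \<in> set p" for x using that unfolding p(2) Union_polygon_edges .
  have dc: "distinct c"
  proof -
    have "distinct (map f [0..<n])"
      using inj by (auto simp: distinct_map inj_on_def) (metis inj less_imp_le nat_neq_iff)
    moreover have "set (map f [0..<n]) \<inter> set (drop j p) = {}"
    proof -
      have "f i \<notin> set (drop j p)" if "i < n" for i
      proof (cases "i = 0")
        case True
        have "s \<notin> set (drop j p)"
        proof
          assume "s \<in> set (drop j p)"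
          then obtain i where "j + i < length p" "p ! (j + i) = p ! 0"
            using p0s by (metis add.commute in_set_conv_nth length_drop less_diff_conv nth_drop j(1) less_imp_le)
          then show False using nth_eq_iff_index_eq[OF dp, of "j + i" 0] j0 by (cases "p = []") auto
        qed
        then show ?thesis using True f by simp
      next
        case False
        then show ?thesis using interior[of i] that setp in_set_dropD by fastforce
      qed
      then show ?thesis by auto
    qed
    ultimately show ?thesis unfolding c_def using dp by simp
  qed
  have notS: "{f 0, f 1} \<notin> S"
  proof -
    obtain T where "T \<in> Pg - {S}" "{f 0, f 1} \<in> T"
      using f(3)[of 0] npos unfolding R_def steps_def by auto
    then show ?thesis using edge_polygon_unique[of S T "f 0" "f 1"] S by blast
  qed
  \<comment> \<open>In a shorter walk the path would be a single edge from \<open>s\<close> to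
    \<open>t\<close> that is also the closing side of \<open>S\<close>, contrary to
    \<open>notS\<close>.\<close>
  have "length c \<ge> 3"
  proof (rule ccontr)
    assume "\<not> length c \<ge> 3"
    then have "n = 1" "j = length p - 1" using len npos j by auto
    moreover have "Suc j = length p" using calculation(2) j by simp
    ultimately show False using SE[of j] j p0s f notS by (simp add: insert_commute)
  qed
  then have T: "polygon_edges c \<in> Pg" using distinct_loop_polygon cw dc by blast
  have "{c ! 0, c ! (Suc 0 mod length c)} \<in> polygon_edges c"
    unfolding polygon_edges_alt using len npos by auto
  moreover have "c ! (Suc 0 mod length c) = f 1" using c1[of 1] npos \<open>length c \<ge> 3\<close> by simp
  ultimately have "polygon_edges c \<noteq> S" using notS c1[of 0] by auto
  moreover have "s \<in> set c" using c1[of 0] f len npos nth_mem[of 0 c] by auto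
  moreover have "t \<in> set c" using c1[of n] f len j nth_mem[of n c] by auto
  ultimately show False
    using common_vertices[OF T S, of s t] st unfolding Union_polygon_edges by simp
qed

text \<open>By \<open>polygon_separates\<close>, only one vertex \<open>g\<close> of
  \<open>S\<close> reaches \<open>z\<close> without using \<open>S\<close>. A connection from any
  other vertex of \<open>S\<close> must use \<open>S\<close>, and without \<open>S\<close> it still
  connects \<open>g\<close> with \<open>z\<close>; conversely, adding \<open>S\<close> to a
  connection from \<open>g\<close> suffices.\<close>

lemma polygon_gate:
  assumes "S \<in> Pg" "z \<in> V"
  shows "\<exists>g\<in>\<Union>S. (g, z) \<in> (steps (Pg - {S}))\<^sup>* \<and>
    (\<forall>w\<in>\<Union>S - {g}. gdist k V E w z = Suc (gdist k V E g z))"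
proof -
  obtain s where s: "s \<in> \<Union>S" "s \<in> V"
    using polygon_nonempty[OF assms(1)] Union_polygon_subset[OF assms(1)] by blast
  obtain \<S> where "\<S> \<subseteq> Pg" "finite \<S>" "card \<S> = gdist k V E s z" "(s, z) \<in> (steps \<S>)\<^sup>*"
    using gdist_attained[OF s(2) assms(2)] .
  then have "(s, z) \<in> (steps Pg)\<^sup>*" using steps_mono by blast
  from steps_last_use[OF this, of S] obtain g where g: "g \<in> \<Union>S" "(g, z) \<in> (steps (Pg - {S}))\<^sup>*"
    using s by blast
  have gV: "g \<in> V" using g Union_polygon_subset assms by blast
  have "gdist k V E w z = Suc (gdist k V E g z)" if w: "w \<in> \<Union>S" "w \<noteq> g" for w
  proof (rule antisym)
    have wV: "w \<in> V" using w Union_polygon_subset assms by blast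
    show "gdist k V E w z \<le> Suc (gdist k V E g z)"
    proof -
      obtain \<S> where \<S>: "\<S> \<subseteq> Pg" "finite \<S>" "card \<S> = gdist k V E g z" "(g, z) \<in> (steps \<S>)\<^sup>*"
        using gdist_attained[OF gV assms(2)] .
      have "(w, g) \<in> (steps (insert S \<S>))\<^sup>*" "(g, z) \<in> (steps (insert S \<S>))\<^sup>*"
        using steps_within_polygon[OF assms(1) w(1) g(1)] \<S>(4)
          steps_mono[of "{S}" "insert S \<S>"] steps_mono[of \<S> "insert S \<S>"] by blast+
      then have "(w, z) \<in> (steps (insert S \<S>))\<^sup>*" by (rule rtrancl_trans)
      then have "gdist k V E w z \<le> card (insert S \<S>)"
        using gdist_le[of w z "insert S \<S>"] \<S> assms wV by simp
      also have "\<dots> \<le> Suc (card \<S>)" by (rule card_insert_le_m1) auto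
      finally show ?thesis using \<S> by simp
    qed
    obtain \<S> where \<S>: "\<S> \<subseteq> Pg" "finite \<S>" "card \<S> = gdist k V E w z" "(w, z) \<in> (steps \<S>)\<^sup>*"
      using gdist_attained[OF wV assms(2)] .
    have sep: "h = g" if "h \<in> \<Union>S" "(h, z) \<in> (steps (\<S> - {S}))\<^sup>*" for h
    proof -
      have "(h, z) \<in> (steps (Pg - {S}))\<^sup>*" using that steps_mono[of "\<S> - {S}" "Pg - {S}"] \<S> by blast
      then have "(h, g) \<in> (steps (Pg - {S}))\<^sup>*" using g(2) rtrancl_steps_sym rtrancl_trans by meson
      then show ?thesis using polygon_separates[OF assms(1) that(1) g(1)] by blast
    qed
    then have gz: "(g, z) \<in> (steps (\<S> - {S}))\<^sup>*" using steps_last_use[OF \<S>(4), of S] w by blast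
    have "S \<in> \<S>"
    proof (rule ccontr)
      assume "S \<notin> \<S>"
      then have "(w, z) \<in> (steps (\<S> - {S}))\<^sup>*" using \<S>(4) by simp
      then show False using sep w by blast
    qed
    have "gdist k V E g z \<le> card (\<S> - {S})" using gdist_le[OF gz] \<S> gV by blast
    then show "Suc (gdist k V E g z) \<le> gdist k V E w z"
      using \<S> \<open>S \<in> \<S>\<close> card_Suc_Diff1[of \<S> S] by simp
  qed
  then show ?thesis using g by blast
qed

text \<open>For distinct \<open>S\<close> and \<open>T\<close> the gates \<open>g\<close> and
  \<open>h\<close> would be equally near \<open>z\<close>. As \<open>x\<close> reaches
  \<open>h\<close> within \<open>T\<close>, \<open>h\<close> cannot reach \<open>z\<close> without
  \<open>S\<close>, or else \<open>x\<close> would be the gate of \<open>S\<close>. So an optimal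
  set for \<open>h\<close> contains \<open>S\<close>, and removing \<open>S\<close> leaves a vertex
  of \<open>S\<close> nearer to \<open>z\<close> than \<open>g\<close>.\<close>

lemma closer_polygon_unique:
  assumes "x \<in> V" "z \<in> V" "S \<in> Pg" "T \<in> Pg" "x \<in> \<Union>S" "x \<in> \<Union>T"
    and S: "s \<in> \<Union>S" "gdist k V E s z < gdist k V E x z"
    and T: "t \<in> \<Union>T" "gdist k V E t z < gdist k V E x z"
  shows "S = T"
proof (rule ccontr)
  assume neq: "S \<noteq> T"
  obtain g where g: "g \<in> \<Union>S" "(g, z) \<in> (steps (Pg - {S}))\<^sup>*"
    "\<And>w. w \<in> \<Union>S \<Longrightarrow> w \<noteq> g \<Longrightarrow> gdist k V E w z = Suc (gdist k V E g z)"
    using polygon_gate[OF assms(3,2)] by blast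
  obtain h where h: "h \<in> \<Union>T"     and h2: "\<And>w. w \<in> \<Union>T \<Longrightarrow> w \<noteq> h \<Longrightarrow> gdist k V E w z = Suc (gdist k V E h z)"
    using polygon_gate[OF assms(4,2)] by blast
  have xg: "x \<noteq> g" using S g(3)[of s] by (cases "s = g") auto
  have xh: "x \<noteq> h" using T h2[of t] by (cases "t = h") auto
  have eq: "gdist k V E g z = gdist k V E h z"
    using g(3)[of x] h2[of x] xg xh assms by simp
  have hV: "h \<in> V" using h Union_polygon_subset assms by blast
  obtain \<S> where \<S>: "\<S> \<subseteq> Pg" "finite \<S>" "card \<S> = gdist k V E h z" "(h, z) \<in> (steps \<S>)\<^sup>*"
    using gdist_attained[OF hV assms(2)] .
  have not_xz: "(x, z) \<notin> (steps (Pg - {S}))\<^sup>*"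
  proof
    assume "(x, z) \<in> (steps (Pg - {S}))\<^sup>*"
    then have "(x, g) \<in> (steps (Pg - {S}))\<^sup>*" using g(2) rtrancl_steps_sym rtrancl_trans by meson
    then show False using polygon_separates[OF assms(3,5) g(1)] xg by blast
  qed
  have xh_steps: "(x, h) \<in> (steps (Pg - {S}))\<^sup>*"
    using steps_within_polygon[OF assms(4,6) h] steps_mono[of "{T}" "Pg - {S}"] neq assms by blast
  have not_hz: "(h, z) \<notin> (steps (\<S> - {S}))\<^sup>*"
  proof
    assume "(h, z) \<in> (steps (\<S> - {S}))\<^sup>*"
    then have "(h, z) \<in> (steps (Pg - {S}))\<^sup>*" using steps_mono[of "\<S> - {S}" "Pg - {S}"] \<S>(1) by blast
    then show False using not_xz rtrancl_trans[OF xh_steps, of z] by simp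
  qed
  then obtain g' where g': "g' \<in> \<Union>S" "(g', z) \<in> (steps (\<S> - {S}))\<^sup>*"
    using steps_last_use[OF \<S>(4), of S] by blast
  have "S \<in> \<S>" using not_hz \<S>(4) by (metis Diff_insert_absorb Diff_empty Diff_insert0)
  have "g' \<in> V" using g' Union_polygon_subset[OF assms(3)] by blast
  then have "gdist k V E g' z \<le> card (\<S> - {S})"
    by (intro gdist_le[OF g'(2)]) (use \<S> in auto)
  then have "gdist k V E g' z < gdist k V E g z"
    using \<S> \<open>S \<in> \<S>\<close> card_Suc_Diff1[of \<S> S] eq by simp
  then show False using g(3)[of g'] g' by (cases "g' = g") auto
qed

text \<open>Take the polygon of the first side in an optimal connection. From the vertex where it is
  last used, the rest of the connection does without it, so this vertex is nearer to
  \<open>z\<close>.\<close>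

lemma closer_polygon_exists:
  assumes "x \<in> V" "z \<in> V" "x \<noteq> z"
  obtains S s where "S \<in> Pg" "x \<in> \<Union>S" "s \<in> \<Union>S" "gdist k V E s z < gdist k V E x z"
proof -
  obtain \<S> where \<S>: "\<S> \<subseteq> Pg" "finite \<S>" "card \<S> = gdist k V E x z" "(x, z) \<in> (steps \<S>)\<^sup>*"
    using gdist_attained[OF assms(1,2)] .
  obtain y where y: "(x, y) \<in> steps \<S>" "(y, z) \<in> (steps \<S>)\<^sup>*"
    using \<S>(4) assms(3) by (meson converse_rtranclE)
  obtain S where S: "S \<in> \<S>" "{x, y} \<in> S" using y unfolding steps_def by blast
  then have "x \<in> \<Union>S" "y \<in> \<Union>S" by blast+
  obtain s where s: "s \<in> \<Union>S" "(s, z) \<in> (steps (\<S> - {S}))\<^sup>*"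
    using steps_last_use[OF y(2), of S] \<open>y \<in> \<Union>S\<close> by blast
  have "gdist k V E s z \<le> card (\<S> - {S})"
    using gdist_le[OF s(2)] \<S> s S Union_polygon_subset by blast
  then have "gdist k V E s z < gdist k V E x z"
    using \<S> S card_Suc_Diff1[of \<S> S] by simp
  then show thesis using that[of S s] S \<S> s \<open>x \<in> \<Union>S\<close> by blast
qed

text \<open>For \<open>k \<ge> 2\<close> the vertex set of a polygon determines the polygon, so
  counting blocks at a vertex amounts to counting polygons.\<close>

lemma block_tree_polygons:
  assumes "k \<ge> 2" "r \<ge> 2"
  shows "block_tree k r V (Union ` Pg) (gdist k V E)"
proof
  have inj: "inj_on Union Pg"
  proof (rule inj_onI)
    fix S T assume ST: "S \<in> Pg" "T \<in> Pg" "\<Union>S = \<Union>T"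
    have "card (\<Union>S) \<ge> 2" using card_Union_polygon ST assms by simp
    then obtain x y where "x \<in> \<Union>S" "y \<in> \<Union>S" "x \<noteq> y"
      by (metis card_2_iff' card_le_Suc0_iff_eq card.infinite not_less_eq_eq numeral_2_eq_2 zero_le)
    then show "S = T" using common_vertices ST by metis
  qed
  show "card {T \<in> Union ` Pg. x \<in> T} = r" if "x \<in> V" for x
  proof -
    have "{T \<in> Union ` Pg. x \<in> T} = Union ` {S \<in> Pg. x \<in> \<Union>S}" by blast
    then show ?thesis using card_polygons[OF that] inj
      by (metis (no_types, lifting) card_image inj_on_subset mem_Collect_eq subsetI)
  qed
  show "S \<inter> T = {x}" if "S \<in> Union ` Pg" "T \<in> Union ` Pg" "S \<noteq> T" "x \<in> S" "x \<in> T" for S T x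
  proof -
    obtain S' T' where "S' \<in> Pg" "T' \<in> Pg" "S = \<Union>S'" "T = \<Union>T'" using \<open>S \<in> _\<close> \<open>T \<in> _\<close> by blast
    then show ?thesis using polygons_meet[of x S' T'] that Union_polygon_subset[of S'] by blast
  qed
  show "\<exists>g\<in>T. \<forall>w\<in>T - {g}. gdist k V E w z = Suc (gdist k V E g z)"
    if "T \<in> Union ` Pg" "z \<in> V" for T z
    using that polygon_gate by blast
  show "\<exists>!T. T \<in> Union ` Pg \<and> x \<in> T \<and> (\<exists>w\<in>T. gdist k V E w z < gdist k V E x z)"
    if xz: "x \<in> V" "z \<in> V" "x \<noteq> z" for x z
  proof -
    obtain S s where S: "S \<in> Pg" "x \<in> \<Union>S" "s \<in> \<Union>S" "gdist k V E s z < gdist k V E x z"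
      using closer_polygon_exists[OF xz] .
    show ?thesis
    proof (rule ex1I[of _ "\<Union>S"])
      show "\<Union>S \<in> Union ` Pg \<and> x \<in> \<Union>S \<and> (\<exists>w\<in>\<Union>S. gdist k V E w z < gdist k V E x z)"
        using S by blast
      fix T assume "T \<in> Union ` Pg \<and> x \<in> T \<and> (\<exists>w\<in>T. gdist k V E w z < gdist k V E x z)"
      then obtain T' t where "T = \<Union>T'" "T' \<in> Pg" "x \<in> \<Union>T'" "t \<in> \<Union>T'"
        "gdist k V E t z < gdist k V E x z" by blast
      then show "T = \<Union>S" using closer_polygon_unique[OF xz(1,2), of T' S t s] S by blast
    qed
  qed
  show "T \<subseteq> V" "card T = k" if "T \<in> Union ` Pg" for T
    using that Union_polygon_subset card_Union_polygon by blast+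
qed (use assms gdist_commute gdist_eq_0_iff in auto)

end

section \<open>Rays and the boundary measure\<close>

context rooted_block_tree
begin

text \<open>The block of the step from \<open>\<omega> m\<close> to \<open>\<omega> (Suc m)\<close>
  has the gate \<open>\<omega> m\<close> for the root, and also for \<open>x\<close>: otherwise
  \<open>x\<close> would lie behind a vertex at distance m + 1 from the root. So the ray moves away
  from \<open>x\<close>.\<close>

lemma d_ray_Suc:
  assumes \<omega>: "range \<omega> \<subseteq> V" "\<omega> 0 = b" "\<And>i j. int (d (\<omega> i) (\<omega> j)) = \<bar>int i - int j\<bar>"
    and x: "x \<in> V" "d x b < m"
  shows "d x (\<omega> (Suc m)) = Suc (d x (\<omega> m))"
proof -
  have V: "\<omega> i \<in> V" for i using \<omega>(1) by blast
  have root: "d (\<omega> i) b = i" for i using \<omega>(3)[of i 0] \<omega>(2) by simp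
  have one: "d (\<omega> (Suc m)) (\<omega> m) = 1" using \<omega>(3)[of "Suc m" m] by simp
  have "\<omega> (Suc m) \<noteq> \<omega> m" using one d_eq_0_iff[OF V V, of "Suc m" m] by simp
  then obtain T where T: "T \<in> B" "\<omega> (Suc m) \<in> T" "gate T (\<omega> m) \<noteq> \<omega> (Suc m)"
    using gate_neq_exists[OF V V] by metis
  have "d (gate T (\<omega> m)) (\<omega> m) = 0" using d_gate[OF T(1) V T(2)] T(3) one by simp
  then have "gate T (\<omega> m) = \<omega> m"
    using d_eq_0_iff[OF _ V] gate_in[OF T(1) V] block_subset[OF T(1)] by blast
  then have mT: "\<omega> m \<in> T" using gate_in[OF T(1) V] by metis
  have gb: "gate T b = \<omega> m"
  proof (rule ccontr)
    assume *: "gate T b \<noteq> \<omega> m"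
    then have "m = Suc (d (gate T b) b)" using d_gate[OF T(1) root_in mT] root by simp
    moreover have "Suc m = Suc (d (gate T b) b)" if "gate T b \<noteq> \<omega> (Suc m)"
      using d_gate[OF T(1) root_in T(2)] that root by simp
    ultimately show False using root[of "Suc m"] by (cases "gate T b = \<omega> (Suc m)") auto
  qed
  have "gate T x = \<omega> m"
  proof (rule ccontr)
    assume *: "gate T x \<noteq> \<omega> m"
    have g: "gate T x \<in> T" "gate T x \<in> V" using gate_in[OF T(1) x(1)] block_subset[OF T(1)] by blast+
    have "d b x = d b (gate T x) + d (gate T x) x"
      using d_through_gate[of T b x "gate T x"] T(1) root_in x(1) * gb by simp
    moreover have "d (gate T x) b = Suc m" using d_gate[OF T(1) root_in g(1)] * gb root by simp
    ultimately show False using x d_commute root_in g(2) by simp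
  qed
  then have "d (\<omega> (Suc m)) x = Suc (d (\<omega> m) x)"
    using d_gate[OF T(1) x(1) T(2)] \<open>\<omega> (Suc m) \<noteq> \<omega> m\<close> by simp
  then show ?thesis using d_commute x(1) V by simp
qed

end

section \<open>The Poisson kernel and integrals over the boundary\<close>

locale boundary_tree =
  rooted_block_tree k r V B "gdist k V E" b + boundary_measure k V E b \<nu>
  for k r :: nat and V :: "'v set" and B :: "'v set set" and E :: "'v set set" and b :: 'v
    and \<nu> :: "(nat \<Rightarrow> 'v) measure"
begin

abbreviation "dist\<^sub>G \<equiv> gdist k V E"
abbreviation "P \<equiv> poisson k r V E b"

lemma boundaryD:
  assumes "\<omega> \<in> space \<nu>"
  shows "range \<omega> \<subseteq> V" "\<omega> 0 = b" "int (dist\<^sub>G (\<omega> i) (\<omega> j)) = \<bar>int i - int j\<bar>"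
    "\<omega> M \<in> sphere M"
proof -
  show *: "range \<omega> \<subseteq> V" "\<omega> 0 = b" "int (dist\<^sub>G (\<omega> i) (\<omega> j)) = \<bar>int i - int j\<bar>" for i j
    using assms unfolding space_boundary boundary_def by auto
  show "\<omega> M \<in> sphere M" unfolding sphere_def using *(1) *(2) *(3)[of M 0] by auto
qed

text \<open>Beyond radius |x| both distances grow by one per step of the ray, by
  \<open>d_ray_Suc\<close>. A common \<open>M\<close> can then serve several vertices.\<close>

lemma busemann_eq:
  assumes \<omega>: "\<omega> \<in> space \<nu>" and x: "x \<in> V" and M: "dist\<^sub>G x b < M"
  shows "busemann k V E b x \<omega> = int M - int (dist\<^sub>G x (\<omega> M))"
proof -
  have "int (dist\<^sub>G b (\<omega> (dist\<^sub>G x b + 1))) = int (dist\<^sub>G x b + 1)"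
    using boundaryD(2)[OF \<omega>] boundaryD(3)[OF \<omega>, of 0 "dist\<^sub>G x b + 1"] by simp
  moreover have "int M - int (dist\<^sub>G x (\<omega> M)) =
      int (dist\<^sub>G x b + 1) - int (dist\<^sub>G x (\<omega> (dist\<^sub>G x b + 1)))"
    using Suc_leI[OF M]
  proof (induction M rule: nat_induct_at_least)
    case (Suc n)
    then show ?case using d_ray_Suc[OF boundaryD(1-3)[OF \<omega>] x, of n] by simp
  qed simp
  ultimately show ?thesis unfolding busemann_def Let_def by linarith
qed

lemma poisson_pos: "P x \<omega> > 0"
  unfolding poisson_def Q_def[symmetric] by (intro zero_less_power_int less_le_trans[OF zero_less_one Q_ge_1])

lemma poisson_powr_cnj:
  "cnj (complex_of_real (P x \<omega>) powr (1/2 + \<i> * of_real l)) =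
    complex_of_real (P x \<omega>) powr (1/2 - \<i> * of_real l)"
  using poisson_pos[of x \<omega>] by (simp add: powr_def Ln_of_real exp_cnj)

text \<open>Separates a factor that depends only on \<open>M\<close> from a power with exponent
  \<open>d(x, \<omega> M)\<close>, the form in which \<open>sum_sphere_kernel\<close>
  applies.\<close>

lemma poisson_powr:
  assumes "\<omega> \<in> space \<nu>" "x \<in> V" "dist\<^sub>G x b < M"
  shows "complex_of_real (P x \<omega>) powr z =
    exp (of_nat M * (z * of_real (ln Q))) * exp (- (z * of_real (ln Q))) ^ dist\<^sub>G x (\<omega> M)"
proof -
  have Q0: "Q > 0" using Q_ge_1 by linarith
  have "P x \<omega> = Q powr of_int (busemann k V E b x \<omega>)"
    unfolding poisson_def Q_def[symmetric] using Q0 by (simp add: powr_real_of_int')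
  then have ln: "ln (P x \<omega>) = (real M - real (dist\<^sub>G x (\<omega> M))) * ln Q"
    using Q0 busemann_eq[OF assms] by (simp add: ln_powr)
  have "complex_of_real (P x \<omega>) powr z = exp (z * of_real (ln (P x \<omega>)))"
    using poisson_pos[of x \<omega>] by (simp add: powr_def Ln_of_real)
  also have "z * of_real (ln (P x \<omega>)) =
      of_nat M * (z * of_real (ln Q)) + of_nat (dist\<^sub>G x (\<omega> M)) * (- (z * of_real (ln Q)))"
    unfolding ln by (simp add: algebra_simps)
  finally show ?thesis unfolding exp_add exp_of_nat_mult .
qed

text \<open>A function of the \<open>M\<close>-th node is a finite combination of indicators of
  cylinders, all of equal mass, so its integral is the average over the sphere of radius
  \<open>M\<close>.\<close>

lemma integral_boundary_level:
  fixes g :: "'v \<Rightarrow> complex"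
  shows "has_bochner_integral \<nu> (\<lambda>\<omega>. g (\<omega> M)) (of_real (1 / real (card (sphere M))) * (\<Sum>z\<in>sphere M. g z))"
proof -
  have sets: "boundary_cyl k V E b z \<in> sets \<nu>" if "z \<in> V" for z
    unfolding sets_boundary
    by (rule sigma_sets.Basic)
      (use that in \<open>auto simp: boundary_topology_def intro!: topology_generated_by_Basis\<close>)
  have cyl: "\<omega> \<in> boundary_cyl k V E b z \<longleftrightarrow> \<omega> M = z" if "\<omega> \<in> space \<nu>" "z \<in> sphere M" for \<omega> z
    using that unfolding boundary_cyl_def space_boundary sphere_def by auto
  have "has_bochner_integral \<nu> (\<lambda>\<omega>. \<Sum>z\<in>sphere M. indicator (boundary_cyl k V E b z) \<omega> *\<^sub>R g z)
      (\<Sum>z\<in>sphere M. measure \<nu> (boundary_cyl k V E b z) *\<^sub>R g z)"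
    by (intro has_bochner_integral_sum has_bochner_integral_indicator sets)
      (auto simp: sphere_def less_top[symmetric])
  moreover have "(\<Sum>z\<in>sphere M. indicator (boundary_cyl k V E b z) \<omega> *\<^sub>R g z) = g (\<omega> M)"
    if "\<omega> \<in> space \<nu>" for \<omega>
  proof -
    have "(\<Sum>z\<in>sphere M. indicator (boundary_cyl k V E b z) \<omega> *\<^sub>R g z) =
        (\<Sum>z\<in>sphere M. if \<omega> M = z then g z else 0)"
      using cyl that by (intro sum.cong) (auto simp: indicator_def)
    then show ?thesis using boundaryD(4)[OF that] finite_sphere by simp
  qed
  moreover have "measure \<nu> (boundary_cyl k V E b z) = 1 / real (card (sphere M))"
    if "z \<in> sphere M" for z
    using that measure_cyl[of z] unfolding sphere_card_def sphere_def by auto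
  ultimately show ?thesis
    by (simp add: sum_distrib_left scaleR_conv_of_real cong: has_bochner_integral_cong)
qed

text \<open>The integrand depends only on the node \<open>\<omega> M\<close> for large
  \<open>M\<close>, so the integral is an average over a sphere, given by
  \<open>sum_sphere_kernel\<close>. The factor \<open>Q ^ M\<close> from the two kernels cancels
  against the size of the sphere.\<close>

lemma poisson_kernel_integral:
  fixes l :: real
  assumes x: "x \<in> V" and y: "y \<in> V"
  shows "has_bochner_integral \<nu>
    (\<lambda>\<omega>. complex_of_real (P y \<omega>) powr (1/2 + \<i> * of_real l) *
      complex_of_real (P x \<omega>) powr (1/2 - \<i> * of_real l))
    (spherical (of_real (Q / (real r * real (k - 1)))) (of_nat (k - 1))
      (of_real (1 / sqrt Q) * cis (- (l * ln Q))) (of_real (1 / sqrt Q) * cis (l * ln Q)) (dist\<^sub>G y x))"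
proof -
  have Q0: "Q > 0" using Q_ge_1 by linarith
  define L where "L = complex_of_real (ln Q)"
  define u v where "u = exp (- ((1/2 + \<i> * of_real l) * L))" and "v = exp (- ((1/2 - \<i> * of_real l) * L))"
  \<comment> \<open>Exceeds |x|, |y| and |x| + d(y,x), as \<open>poisson_powr\<close> and
    \<open>sum_sphere_kernel\<close> require.\<close>
  define M where "M = dist\<^sub>G x b + dist\<^sub>G y x + dist\<^sub>G y b + 1"
  have half: "exp (- (1/2 * L)) = of_real (1 / sqrt Q)"
  proof -
    have *: "sqrt Q = exp (1/2 * ln Q)" using Q0 by (simp add: powr_half_sqrt[symmetric] powr_def)
    have "exp (- (1/2 * ln Q)) = 1 / sqrt Q" unfolding * exp_minus divide_inverse mult_1 ..
    moreover have "exp (- (1/2 * L)) = of_real (exp (- (1/2 * ln Q)))"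
      unfolding exp_of_real[symmetric] by (simp add: L_def)
    ultimately show ?thesis by simp
  qed
  have u: "u = of_real (1 / sqrt Q) * cis (- (l * ln Q))"
    and v: "v = of_real (1 / sqrt Q) * cis (l * ln Q)"
    unfolding u_def v_def half[symmetric] cis_conv_exp exp_add[symmetric]
    by (simp_all add: L_def algebra_simps)
  have "u * v = exp (of_real (- ln Q))"
    unfolding u_def v_def exp_add[symmetric] by (simp add: L_def algebra_simps)
  then have uv: "u * v = of_real (1 / Q)"
    using Q0 by (simp add: exp_of_real exp_minus divide_inverse)
  have QM: "exp (of_nat M * ((1/2 + \<i> * of_real l) * L)) * exp (of_nat M * ((1/2 - \<i> * of_real l) * L)) =
      of_real (Q ^ M)"
  proof -
    have "exp (of_nat M * ((1/2 + \<i> * of_real l) * L)) * exp (of_nat M * ((1/2 - \<i> * of_real l) * L)) =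
        exp (of_nat M * L)" unfolding exp_add[symmetric] by (simp add: algebra_simps)
    also have "\<dots> = of_real (exp (ln Q)) ^ M" unfolding exp_of_nat_mult by (simp add: L_def exp_of_real)
    finally show ?thesis using Q0 by simp
  qed
  define g where "g z = of_real (Q ^ M) * (u ^ dist\<^sub>G y z * v ^ dist\<^sub>G x z)" for z
  have integrand: "complex_of_real (P y \<omega>) powr (1/2 + \<i> * of_real l) *
      complex_of_real (P x \<omega>) powr (1/2 - \<i> * of_real l) = g (\<omega> M)" if "\<omega> \<in> space \<nu>" for \<omega>
    using poisson_powr[OF that y, of M] poisson_powr[OF that x, of M]
    unfolding g_def QM[symmetric] by (simp add: M_def u_def v_def L_def mult_ac)
  have kernel: "(\<Sum>z\<in>sphere M. u ^ dist\<^sub>G y z * v ^ dist\<^sub>G x z) =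
      of_real (real r * real (k - 1) / Q) *
      spherical (of_real (Q / (real r * real (k - 1)))) (of_nat (k - 1)) u v (dist\<^sub>G y x)"
    by (rule sum_sphere_kernel(2)[OF uv x y]) (simp add: M_def)
  have "of_real (1 / real (card (sphere M))) * (\<Sum>z\<in>sphere M. g z) =
      of_real (1 / real (card (sphere M)) * Q ^ M * (real r * real (k - 1) / Q)) *
      spherical (of_real (Q / (real r * real (k - 1)))) (of_nat (k - 1)) u v (dist\<^sub>G y x)"
    unfolding g_def sum_distrib_left[symmetric] kernel of_real_mult by (simp only: mult_ac)
  also have "1 / real (card (sphere M)) * Q ^ M * (real r * real (k - 1) / Q) = 1"
    using card_sphere[of M] Q0 k_ge_2 r_ge_2 by (simp add: M_def)
  finally show ?thesis
    using integral_boundary_level[of g M] integrand unfolding u v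
    by (simp cong: has_bochner_integral_cong)
qed

lemma hf_transform_eq:
  assumes "f \<in> finsupp V"
  shows "hf_transform k r V E b f l \<omega> =
    (\<Sum>y | y \<in> V \<and> f y \<noteq> 0. f y * complex_of_real (P y \<omega>) powr (1/2 + \<i> * l))"
proof -
  have "hf_transform k r V E b f l \<omega> =
      (\<Sum>\<^sub>\<infinity>y\<in>{y. y \<in> V \<and> f y \<noteq> 0}. f y * complex_of_real (P y \<omega>) powr (1/2 + \<i> * l))"
    unfolding hf_transform_def by (rule infsum_cong_neutral) auto
  then show ?thesis using assms by (simp add: finsupp_def)
qed

definition density :: "nat \<Rightarrow> real \<Rightarrow> complex" where
  "density n l = spherical (of_real (Q / (real r * real (k - 1)))) (of_nat (k - 1))
      (of_real (1 / sqrt Q) * cis (- (l * ln Q))) (of_real (1 / sqrt Q) * cis (l * ln Q)) n *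
    of_real (cmod (c_fun k r (of_real l)) powi (- 2))"

lemma inner_integral:
  assumes f: "f \<in> finsupp V" and x: "x \<in> V"
  shows "has_bochner_integral \<nu>
    (\<lambda>\<omega>. hf_transform k r V E b f (of_real l) \<omega> *
      complex_of_real (P x \<omega>) powr (1/2 - \<i> * of_real l) *
      of_real (cmod (c_fun k r (of_real l)) powi (- 2)))
    (\<Sum>y | y \<in> V \<and> f y \<noteq> 0. f y * density (dist\<^sub>G y x) l)"
proof -
  let ?W = "complex_of_real (cmod (c_fun k r (of_real l)) powi (- 2))"
  have "has_bochner_integral \<nu> (\<lambda>\<omega>. \<Sum>y | y \<in> V \<and> f y \<noteq> 0. f y *
      (complex_of_real (P y \<omega>) powr (1/2 + \<i> * of_real l) *
        complex_of_real (P x \<omega>) powr (1/2 - \<i> * of_real l) * ?W))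
    (\<Sum>y | y \<in> V \<and> f y \<noteq> 0. f y * density (dist\<^sub>G y x) l)"
    unfolding density_def
    by (intro has_bochner_integral_sum has_bochner_integral_mult_right has_bochner_integral_mult_left
        poisson_kernel_integral x) auto
  then show ?thesis
    by (simp add: hf_transform_eq[OF f] sum_distrib_right mult.assoc)
qed

section \<open>The inversion and Plancherel formulas\<close>

context
  assumes Q_gt_1: "Q > 1" and k_le_r: "k \<le> r"
begin

abbreviation (input) "plancherel_const \<equiv> 1 / (2 * pi) * (Q * ln Q / (real r * (real k - 1)))"

lemma density_integral:
  "has_bochner_integral lborel (\<lambda>l. indicator {0..pi / ln Q} l *\<^sub>R (of_real plancherel_const * density n l))
    (if n = 0 then 1 else 0)"
proof -
  have k1: "real (k - 1) = real k - 1" using k_ge_2 by simp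
  note * = spherical_plancherel[OF k_ge_2 k_le_r, folded Q_def, OF Q_gt_1, where n = n, folded density_def]
  have "has_bochner_integral lborel (\<lambda>l. indicator {0..pi / ln Q} l *\<^sub>R density n l)
      (LINT l:{0..pi / ln Q}|lborel. density n l)"
    using *(1) unfolding set_integrable_def set_lebesgue_integral_def by (rule has_bochner_integral_integrable)
  from has_bochner_integral_mult_right[OF this, of "of_real plancherel_const"] show ?thesis
    unfolding *(2)[unfolded k1] mult_scaleR_right .
qed

text \<open>After expansion of the transform, each \<open>y\<close> contributes \<open>f y\<close>
  times an integral of \<open>density\<close>, which is 1 for \<open>y = x\<close> and 0
  otherwise.\<close>

lemma inversion_integral:
  assumes f: "f \<in> finsupp V" and x: "x \<in> V"
  shows "has_bochner_integral lborel
    (\<lambda>l. indicator {0..pi / ln Q} l *\<^sub>R (of_real plancherel_const * (LINT \<omega>|\<nu>.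
       hf_transform k r V E b f (of_real l) \<omega> *
       complex_of_real (P x \<omega>) powr (1/2 - \<i> * of_real l) *
       of_real (cmod (c_fun k r (of_real l)) powi (- 2))))) (f x)"
proof -
  let ?F = "{y. y \<in> V \<and> f y \<noteq> 0}"
  have fin: "finite ?F" using f by (simp add: finsupp_def)
  have "has_bochner_integral lborel (\<lambda>l. \<Sum>y\<in>?F. f y *
      (indicator {0..pi / ln Q} l *\<^sub>R (of_real plancherel_const * density (dist\<^sub>G y x) l)))
      (\<Sum>y\<in>?F. f y * (if dist\<^sub>G y x = 0 then 1 else 0))"
    by (intro has_bochner_integral_sum has_bochner_integral_mult_right density_integral)
  also have "(\<Sum>y\<in>?F. f y * (if dist\<^sub>G y x = 0 then 1 else 0)) = (\<Sum>y\<in>?F. if x = y then f y else 0)"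
    using d_eq_0_iff x by (intro sum.cong) auto
  also have "\<dots> = f x" using fin x by simp
  also have "(\<lambda>l. \<Sum>y\<in>?F. f y *
      (indicator {0..pi / ln Q} l *\<^sub>R (of_real plancherel_const * density (dist\<^sub>G y x) l))) =
    (\<lambda>l. indicator {0..pi / ln Q} l *\<^sub>R (of_real plancherel_const * (\<Sum>y\<in>?F. f y * density (dist\<^sub>G y x) l)))"
  proof
    fix l
    show "(\<Sum>y\<in>?F. f y * (indicator {0..pi / ln Q} l *\<^sub>R (of_real plancherel_const * density (dist\<^sub>G y x) l))) =
      indicator {0..pi / ln Q} l *\<^sub>R (of_real plancherel_const * (\<Sum>y\<in>?F. f y * density (dist\<^sub>G y x) l))"
      unfolding sum_distrib_left scaleR_sum_right mult_scaleR_right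
      by (intro sum.cong refl arg_cong[where f = "scaleR _"]) (rule mult.left_commute)
  qed
  finally show ?thesis
    unfolding has_bochner_integral_integral_eq[OF inner_integral[OF f x]] .
qed

text \<open>For real \<open>l\<close> the conjugate of the transform is the sum of
  \<open>cnj (f x)\<close> times the kernel with exponent 1/2 - i l. So the squared modulus
  integrates to the inversion formula summed against \<open>cnj (f x)\<close>; the cast to complex
  numbers makes this possible.\<close>

lemma plancherel_integral:
  assumes f: "f \<in> finsupp V"
  shows "has_bochner_integral lborel
    (\<lambda>l. complex_of_real (indicator {0..pi / ln Q} l *\<^sub>R (plancherel_const * (LINT \<omega>|\<nu>.
       (cmod (hf_transform k r V E b f (of_real l) \<omega>))\<^sup>2 *
       cmod (c_fun k r (of_real l)) powi (- 2)))))
    (of_real (\<Sum>\<^sub>\<infinity>x\<in>V. (cmod (f x))\<^sup>2))"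
proof -
  let ?F = "{y. y \<in> V \<and> f y \<noteq> 0}"
  let ?fhat = "\<lambda>l \<omega>. hf_transform k r V E b f (of_real l) \<omega>"
  let ?W = "\<lambda>l. cmod (c_fun k r (complex_of_real l)) powi (- 2)"
  let ?I = "\<lambda>x l. LINT \<omega>|\<nu>. ?fhat l \<omega> * complex_of_real (P x \<omega>) powr (1/2 - \<i> * of_real l) * of_real (?W l)"
  have inner: "complex_of_real (LINT \<omega>|\<nu>. (cmod (?fhat l \<omega>))\<^sup>2 * ?W l) = (\<Sum>x\<in>?F. cnj (f x) * ?I x l)" for l
  proof -
    have sq: "complex_of_real ((cmod (?fhat l \<omega>))\<^sup>2 * ?W l) = (\<Sum>x\<in>?F. cnj (f x) *
        (?fhat l \<omega> * complex_of_real (P x \<omega>) powr (1/2 - \<i> * of_real l) * of_real (?W l)))" for \<omega>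
    proof -
      have "cnj (?fhat l \<omega>) = (\<Sum>x\<in>?F. cnj (f x) * complex_of_real (P x \<omega>) powr (1/2 - \<i> * of_real l))"
        unfolding hf_transform_eq[OF f] by (simp only: cnj_sum complex_cnj_mult poisson_powr_cnj)
      then have "complex_of_real ((cmod (?fhat l \<omega>))\<^sup>2 * ?W l) = ?fhat l \<omega> *
          (\<Sum>x\<in>?F. cnj (f x) * complex_of_real (P x \<omega>) powr (1/2 - \<i> * of_real l)) * of_real (?W l)"
        by (simp only: of_real_mult complex_norm_square)
      then show ?thesis by (simp only: sum_distrib_left sum_distrib_right mult_ac)
    qed
    have "complex_of_real (LINT \<omega>|\<nu>. (cmod (?fhat l \<omega>))\<^sup>2 * ?W l) =
        (LINT \<omega>|\<nu>. complex_of_real ((cmod (?fhat l \<omega>))\<^sup>2 * ?W l))"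
      by (rule integral_complex_of_real[symmetric])
    also have "\<dots> = (\<Sum>x\<in>?F. LINT \<omega>|\<nu>. cnj (f x) *
        (?fhat l \<omega> * complex_of_real (P x \<omega>) powr (1/2 - \<i> * of_real l) * of_real (?W l)))"
      unfolding sq
      by (intro Bochner_Integration.integral_sum integrable_mult_right)
        (use inner_integral[OF f] in \<open>auto intro: integrable.intros\<close>)
    finally show ?thesis by simp
  qed
  have "has_bochner_integral lborel (\<lambda>l. \<Sum>x\<in>?F. cnj (f x) *
      (indicator {0..pi / ln Q} l *\<^sub>R (of_real plancherel_const * ?I x l))) (\<Sum>x\<in>?F. cnj (f x) * f x)"
    by (intro has_bochner_integral_sum has_bochner_integral_mult_right inversion_integral f) auto
  also have "(\<Sum>x\<in>?F. cnj (f x) * f x) = of_real (\<Sum>\<^sub>\<infinity>x\<in>V. (cmod (f x))\<^sup>2)"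
  proof -
    have "(\<Sum>\<^sub>\<infinity>x\<in>V. (cmod (f x))\<^sup>2) = (\<Sum>\<^sub>\<infinity>x\<in>?F. (cmod (f x))\<^sup>2)"
      by (rule infsum_cong_neutral) auto
    also have "\<dots> = (\<Sum>x\<in>?F. (cmod (f x))\<^sup>2)" using f by (simp add: finsupp_def)
    finally show ?thesis by (simp add: complex_norm_square mult.commute del: of_real_power)
  qed
  also have "(\<lambda>l. \<Sum>x\<in>?F. cnj (f x) * (indicator {0..pi / ln Q} l *\<^sub>R (of_real plancherel_const * ?I x l))) =
      (\<lambda>l. complex_of_real (indicator {0..pi / ln Q} l *\<^sub>R (plancherel_const *
        (LINT \<omega>|\<nu>. (cmod (?fhat l \<omega>))\<^sup>2 * ?W l))))"
  proof
    fix l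
    have "complex_of_real (indicator {0..pi / ln Q} l *\<^sub>R (plancherel_const *
        (LINT \<omega>|\<nu>. (cmod (?fhat l \<omega>))\<^sup>2 * ?W l))) =
      of_real (indicator {0..pi / ln Q} l) * (of_real plancherel_const * (\<Sum>x\<in>?F. cnj (f x) * ?I x l))"
      unfolding inner[symmetric] by simp
    then show "(\<Sum>x\<in>?F. cnj (f x) * (indicator {0..pi / ln Q} l *\<^sub>R (of_real plancherel_const * ?I x l))) =
        complex_of_real (indicator {0..pi / ln Q} l *\<^sub>R (plancherel_const *
        (LINT \<omega>|\<nu>. (cmod (?fhat l \<omega>))\<^sup>2 * ?W l)))"
      by (simp only: scaleR_conv_of_real sum_distrib_left mult_ac)
  qed
  finally show ?thesis .
qed

end

end

theorem lemma3p10: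
  fixes k r :: nat and V :: "'v set" and E :: "'v set set" and b :: 'v
    and \<nu> :: "(nat \<Rightarrow> 'v) measure" and Q \<tau> :: real
  assumes "k \<ge> 2" and "r \<ge> 2" and "k \<le> r"
    and "symmetric_graph k r V E" and "b \<in> V"
    and "boundary_measure k V E b \<nu>"
    and "Q = real ((r - 1) * (k - 1))" and "Q > 1" and "\<tau> = 2 * pi / ln Q"
  shows
    "(\<forall>f\<in>finsupp V.
        (\<Sum>\<^sub>\<infinity>x\<in>V. (cmod (f x))\<^sup>2) =
          1 / (2 * pi) * (Q * ln Q / (real r * (real k - 1))) *
          (LINT l:{0..\<tau>/2}|lborel. (LINT \<omega>|\<nu>.
             (cmod (hf_transform k r V E b f (of_real l) \<omega>))\<^sup>2 *
             cmod (c_fun k r (of_real l)) powi (- 2)))) \<and>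
     (\<forall>f\<in>finsupp V. \<forall>x\<in>V.
        f x =
          of_real (1 / (2 * pi) * (Q * ln Q / (real r * (real k - 1)))) *
          (LINT l:{0..\<tau>/2}|lborel. (LINT \<omega>|\<nu>.
             hf_transform k r V E b f (of_real l) \<omega> *
             complex_of_real (poisson k r V E b x \<omega>) powr (1/2 - \<i> * of_real l) *
             of_real (cmod (c_fun k r (of_real l)) powi (- 2)))))"
proof -
  interpret G: symmetric_graph k r V E by fact
  interpret boundary_measure k V E b \<nu> by fact
  interpret block_tree k r V "Union ` polygons k V E" "gdist k V E"
    by (rule G.block_tree_polygons) fact+
  interpret boundary_tree k r V "Union ` polygons k V E" E b \<nu> by unfold_locales fact
  have Q: "rooted_block_tree.Q k r = Q" using assms(7) by (simp add: Q_def)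
  have \<tau>: "\<tau> / 2 = pi / ln Q" using assms(9) by simp
  note gt1 = assms(8)[folded Q]
  show ?thesis
    unfolding \<tau>
  proof (intro conjI ballI)
    fix f assume f: "f \<in> finsupp V"
    \<comment> \<open>The identity between complex numbers is read back as one between
      reals.\<close>
    from has_bochner_integral_integral_eq[OF plancherel_integral[OF gt1 assms(3) f, unfolded Q]]
    show "(\<Sum>\<^sub>\<infinity>x\<in>V. (cmod (f x))\<^sup>2) =
          1 / (2 * pi) * (Q * ln Q / (real r * (real k - 1))) *
          (LINT l:{0..pi / ln Q}|lborel. (LINT \<omega>|\<nu>.
             (cmod (hf_transform k r V E b f (of_real l) \<omega>))\<^sup>2 *
             cmod (c_fun k r (of_real l)) powi (- 2)))"
      unfolding integral_complex_of_real of_real_eq_iff mult_scaleR_right[symmetric]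
        integral_mult_right_zero set_lebesgue_integral_def by (rule sym)
    fix x assume x: "x \<in> V"
    from has_bochner_integral_integral_eq[OF inversion_integral[OF gt1 assms(3) f x, unfolded Q]]
    show "f x =
          of_real (1 / (2 * pi) * (Q * ln Q / (real r * (real k - 1)))) *
          (LINT l:{0..pi / ln Q}|lborel. (LINT \<omega>|\<nu>.
             hf_transform k r V E b f (of_real l) \<omega> *
             complex_of_real (poisson k r V E b x \<omega>) powr (1/2 - \<i> * of_real l) *
             of_real (cmod (c_fun k r (of_real l)) powi (- 2))))"
      unfolding mult_scaleR_right[symmetric] integral_mult_right_zero set_lebesgue_integral_def
      by (rule sym)
  qed
qed

end
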